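(* Let $k\ge1$, let $\lambda_1>k-1$ be rational and let $p_1,\dots,p_{k-1}$ be natural integers. Then the canonical family parametrized by $\mathcal S(\lambda_1,p_1,\dots,p_{k-1})$ is a holomorphic family of rank $k$ themes.
   Context: $\tilde{\mathcal A}$ is the $\mathbb C$-algebra of formal series $\sum_{\nu\ge0}P_\nu(a)b^\nu$ ($P_\nu\in\mathbb C[z]$) with product determined by $ab-ba=b^2$ and $b$-adic continuity of multiplication by $a$. An (a,b)-module is a left $\tilde{\mathcal A}$-module free of finite rank over $\mathbb C[[b]]$. For rational $\lambda\in]0,1]$, $\Xi_\lambda=\bigoplus_{j\ge0}\mathbb C[[b]]e_{\lambda,j}$ (finite sums; $e_{\lambda,j}$ stands for $s^{\lambda-1}(\log s)^j/j!$), $ae_{\lambda,0}=\lambda be_{\lambda,0}$, $ae_{\lambda,j}=\lambda be_{\lambda,j}+be_{\lambda,j-1}$, extended by $aS(b)=S(b)a+b^2S'(b)$; $\Xi=\bigoplus\Xi_\lambda$; a theme is a left $\tilde{\mathcal A}$-module isomorphic to some $\tilde{\mathcal A}\varphi\subset\Xi$. Parameter space: put $\lambda_{j+1}=\lambda_j+p_j-1$. For $j\in[1,k-1]$ let $V_j\subset\mathbb C[b]$ be: $\bigoplus_{i=0}^{k-j-1}\mathbb Cb^i$ if $p_j+\dots+p_{k-1}<k-j$; otherwise $\bigoplus_{i=0}^{k-j-1}\mathbb Cb^i\oplus\mathbb Cb^{q_j}$ with $q_j=p_j+\dots+p_{j+h}$, $h\ge0$ minimal with $q_j\ge k-j$.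 Let $W_j=\{S\in V_j: S(0)=1,\ \text{coefficient of }b^{p_j}\text{ in }S\ne0\}$ and $\mathcal S(\lambda_1,p_1,\dots,p_{k-1})=W_1\times\dots\times W_{k-1}$ (a connected complex manifold). For $\sigma=(S_1,\dots,S_{k-1})$ put $P(\sigma)=(a-\lambda_1b)S_1^{-1}(a-\lambda_2b)S_2^{-1}\cdots S_{k-1}^{-1}(a-\lambda_kb)$ and $E(\sigma)=\tilde{\mathcal A}/\tilde{\mathcal A}P(\sigma)$. The canonical family is the family $(E(\sigma))_{\sigma\in\mathcal S}$, given by the sheaf $\tilde{\mathcal A}_{\mathcal S}/\tilde{\mathcal A}_{\mathcal S}P$, where $\tilde{\mathcal A}_{\mathcal S}$ is the analogue of $\tilde{\mathcal A}$ with coefficients in $\mathcal O_{\mathcal S}$ and $P$ has coefficients depending holomorphically on $\sigma$. Holomorphic families: for a reduced complex space $X$, $\mathcal O_X[[b]]$ is the sheaf associated to $U\mapsto\mathcal O_X(U)[[b]]$; a sheaf of $\mathcal O_X$-(a,b)-modules is a locally free finite type $\mathcal O_X[[b]]$-module $\mathbb E$ with $\mathcal O_X$-linear $b$-adically continuous $a$, $ab-ba=b^2$; fiber $E(x)=\mathbb E/\mathcal M_x[[b]]\mathbb E$. $\Xi^{(N)}_{X,\Lambda}=\bigoplus_{\lambda\in\Lambda}\bigoplus_{j=0}^N\mathcal O_X[[b]]e_{\lambda,j}$ (same $a$); a holomorphic map $\varphi:X\to\Xi^{(N)}_\Lambda$ is a global section; it is $k$-thematic if the $\mathcal O_X[[b]]$-submodule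 $\mathbb E_\varphi$ generated by the $a^\nu\varphi$ is free with basis $\varphi,\dots,a^{k-1}\varphi$. A holomorphic family of rank $k$ themes is a sheaf of $\mathcal O_X$-(a,b)-modules locally isomorphic to some $\mathbb E_\varphi$ with $\varphi$ $k$-thematic. *)

theory Defs
  imports "HOL-Analysis.Analysis" "HOL-Computational_Algebra.Polynomial_FPS" "HOL-Library.Function_Algebras"
begin

text \<open>Parameter points: finitely supported coordinate vectors (j,i) \<mapsto> coefficient of b^i in S_j.\<close>
type_synonym pt = "nat \<times> nat \<Rightarrow> complex"

definition lam :: "rat \<Rightarrow> (nat \<Rightarrow> nat) \<Rightarrow> nat \<Rightarrow> rat" where
  "lam l1 p j = l1 + (\<Sum>i\<in>{1..<j}. (of_nat (p i) - 1))"

definition smallcase :: "nat \<Rightarrow> (nat \<Rightarrow> nat) \<Rightarrow> nat \<Rightarrow> bool" where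
  "smallcase k p j \<longleftrightarrow> (\<Sum>i\<in>{j..k-1}. p i) < k - j"

definition qq :: "nat \<Rightarrow> (nat \<Rightarrow> nat) \<Rightarrow> nat \<Rightarrow> nat" where
  "qq k p j = (\<Sum>i\<in>{j..j + (LEAST h. (\<Sum>i\<in>{j..j+h}. p i) \<ge> k - j)}. p i)"

text \<open>Free coordinates: (j,i) with 1 \<le> j \<le> k-1 and either 1 \<le> i \<le> k-j-1 or i = q_j (second case).
  (The coefficient of b^0 is fixed to 1.)\<close>
definition Icoord :: "nat \<Rightarrow> (nat \<Rightarrow> nat) \<Rightarrow> (nat \<times> nat) set" where
  "Icoord k p = {(j,i). 1 \<le> j \<and> j \<le> k - 1 \<and>
      ((1 \<le> i \<and> i \<le> k - j - 1) \<or> (\<not> smallcase k p j \<and> i = qq k p j))}"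

text \<open>The ambient affine space V_1 x ... x V_(k-1) (in coordinates).\<close>
definition Lsp :: "(nat \<times> nat) set \<Rightarrow> pt set" where
  "Lsp I = {z. \<forall>c. c \<notin> I \<longrightarrow> z c = 0}"

definition Spoly :: "(nat \<times> nat) set \<Rightarrow> pt \<Rightarrow> nat \<Rightarrow> complex poly" where
  "Spoly I z j = 1 + (\<Sum>i\<in>{i. (j,i) \<in> I}. monom (z (j,i)) i)"

definition Sspace :: "nat \<Rightarrow> (nat \<Rightarrow> nat) \<Rightarrow> pt set" where
  "Sspace k p = {z \<in> Lsp (Icoord k p).
      \<forall>j\<in>{1..k-1}. coeff (Spoly (Icoord k p) z j) (p j) \<noteq> 0}"

text \<open>Holomorphic functions on a (relatively) open subset U of the coordinate space
  C^I (I finite): continuous and holomorphic in each variable separately (Osgood).\<close>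
definition holo_on :: "(nat \<times> nat) set \<Rightarrow> pt set \<Rightarrow> (pt \<Rightarrow> complex) \<Rightarrow> bool" where
  "holo_on I U f \<longleftrightarrow> continuous_on U f \<and>
     (\<forall>z\<in>U. \<forall>c\<in>I. (\<lambda>w. f (z(c := w))) field_differentiable
                        (at (z c) within {w. z(c := w) \<in> U}))"

definition openS :: "(nat \<times> nat) set \<Rightarrow> pt set \<Rightarrow> bool" where
  "openS I U \<longleftrightarrow> openin (top_of_set (Lsp I)) U"

text \<open>Sections of O[[b]] over U: coefficient sequences of holomorphic functions.\<close>
type_synonym fs = "nat \<Rightarrow> pt \<Rightarrow> complex"

definition hol_fs :: "(nat \<times> nat) set \<Rightarrow> pt set \<Rightarrow> fs \<Rightarrow> bool" where
  "hol_fs I U S \<longleftrightarrow> (\<forall>n. holo_on I U (S n))"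

section \<open>The algebra A~ (pointwise): normal ordered series sum_nu P_nu(a) b^nu\<close>

text \<open>x nu i = coefficient of a^i b^nu.\<close>
type_synonym nc = "nat \<Rightarrow> nat \<Rightarrow> complex"

text \<open>bna n j m i = coefficient of a^i b^m in the normal ordering of b^n a^j
  (using b^m a = a b^m - m b^(m+1), which follows from ab - ba = b^2).\<close>
fun bna :: "nat \<Rightarrow> nat \<Rightarrow> nat \<Rightarrow> nat \<Rightarrow> complex" where
  "bna n 0 m i = (if i = 0 \<and> m = n then 1 else 0)"
| "bna n (Suc j) m i =
     (if i = 0 then 0 else bna n j m (i - 1))
     - (if m = 0 then 0 else of_nat (m - 1) * bna n j (m - 1) i)"

definition ncmul :: "nc \<Rightarrow> nc \<Rightarrow> nc" where
  "ncmul x y s r = (\<Sum>\<nu>\<le>s. \<Sum>\<mu>\<le>s. \<Sum>i\<le>r. \<Sum>j\<le>r+s.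
       x \<nu> i * y \<mu> j * bna \<nu> j (s - \<mu>) (r - i))"

definition nc_one :: nc where "nc_one \<nu> i = (if \<nu> = 0 \<and> i = 0 then 1 else 0)"
definition nc_a :: nc where "nc_a \<nu> i = (if \<nu> = 0 \<and> i = 1 then 1 else 0)"
definition nc_b :: nc where "nc_b \<nu> i = (if \<nu> = 1 \<and> i = 0 then 1 else 0)"
definition nc_ser :: "(nat \<Rightarrow> complex) \<Rightarrow> nc" where
  "nc_ser f \<nu> i = (if i = 0 then f \<nu> else 0)"

definition Pfac :: "nat \<Rightarrow> rat \<Rightarrow> (nat \<Rightarrow> nat) \<Rightarrow> pt \<Rightarrow> nc list" where
  "Pfac k l1 p z =
     concat (map (\<lambda>j. [(\<lambda>\<nu> i. nc_a \<nu> i - of_rat (lam l1 p j) * nc_b \<nu> i),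
                       nc_ser (fps_nth (inverse (fps_of_poly (Spoly (Icoord k p) z j))))])
                 [1..<k])
     @ [(\<lambda>\<nu> i. nc_a \<nu> i - of_rat (lam l1 p k) * nc_b \<nu> i)]"

definition Pcan :: "nat \<Rightarrow> rat \<Rightarrow> (nat \<Rightarrow> nat) \<Rightarrow> pt \<Rightarrow> nc" where
  "Pcan k l1 p z = foldr ncmul (Pfac k l1 p z) nc_one"

text \<open>Sections over U of the sheaf A~_S: coefficients holomorphic, each P_nu a polynomial in a.\<close>
definition ATU :: "(nat \<times> nat) set \<Rightarrow> pt set \<Rightarrow> (pt \<Rightarrow> nc) set" where
  "ATU I U = {X. (\<forall>\<nu> i. holo_on I U (\<lambda>z. X z \<nu> i)) \<and>
                 (\<forall>\<nu>. \<exists>d. \<forall>i>d. \<forall>z\<in>U. X z \<nu> i = 0)}"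

definition congP :: "(nat \<times> nat) set \<Rightarrow> pt set \<Rightarrow> (pt \<Rightarrow> nc) \<Rightarrow> (pt \<Rightarrow> nc) \<Rightarrow> (pt \<Rightarrow> nc) \<Rightarrow> bool" where
  "congP I V P X X' \<longleftrightarrow> (\<exists>Y\<in>ATU I V. \<forall>z\<in>V. X z - X' z = ncmul (Y z) (P z))"

text \<open>x lam m j = coefficient of b^m e_(lam,j).\<close>
type_synonym xi = "rat \<Rightarrow> nat \<Rightarrow> nat \<Rightarrow> complex"

text \<open>a (b^m e_(l,j)) = (l+m) b^(m+1) e_(l,j) + b^(m+1) e_(l,j-1).\<close>
definition xi_a :: "xi \<Rightarrow> xi" where
  "xi_a x l m j = (if m = 0 then 0
                   else (of_rat l + of_nat (m - 1)) * x l (m - 1) j + x l (m - 1) (Suc j))"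

definition xi_smul :: "(nat \<Rightarrow> complex) \<Rightarrow> xi \<Rightarrow> xi" where
  "xi_smul S x l m j = (\<Sum>n\<le>m. S n * x l (m - n) j)"

definition XiN :: "(nat \<times> nat) set \<Rightarrow> pt set \<Rightarrow> rat set \<Rightarrow> nat \<Rightarrow> (pt \<Rightarrow> xi) set" where
  "XiN I U \<Lambda> N = {\<phi>. (\<forall>l m j. holo_on I U (\<lambda>z. \<phi> z l m j)) \<and>
       (\<forall>z\<in>U. \<forall>l m j. (l \<notin> \<Lambda> \<or> j > N) \<longrightarrow> \<phi> z l m j = 0)}"

definition Ephi :: "nat \<Rightarrow> (nat \<times> nat) set \<Rightarrow> pt set \<Rightarrow> (pt \<Rightarrow> xi) \<Rightarrow> (pt \<Rightarrow> xi) set" where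
  "Ephi k I V \<phi> = {\<Psi>. \<exists>S :: nat \<Rightarrow> fs. (\<forall>i<k. hol_fs I V (S i)) \<and>
       (\<forall>z\<in>V. \<Psi> z = (\<Sum>i<k. xi_smul (\<lambda>n. S i n z) ((xi_a ^^ i) (\<phi> z))))}"

text \<open>k-thematic: the O[[b]]-module generated by the a^nu phi is free with basis
  phi, ..., a^(k-1) phi (on every open V \<subseteq> U).\<close>
definition thematic :: "nat \<Rightarrow> (nat \<times> nat) set \<Rightarrow> pt set \<Rightarrow> rat set \<Rightarrow> nat \<Rightarrow> (pt \<Rightarrow> xi) \<Rightarrow> bool" where
  "thematic k I U \<Lambda> N \<phi> \<longleftrightarrow> \<phi> \<in> XiN I U \<Lambda> N \<and>
     (\<forall>V. openS I V \<and> V \<subseteq> U \<longrightarrow>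
        (\<forall>\<nu>. (\<lambda>z. (xi_a ^^ \<nu>) (\<phi> z)) \<in> Ephi k I V \<phi>) \<and>
        (\<forall>S :: nat \<Rightarrow> fs. (\<forall>i<k. hol_fs I V (S i)) \<and>
             (\<forall>z\<in>V. (\<Sum>i<k. xi_smul (\<lambda>n. S i n z) ((xi_a ^^ i) (\<phi> z))) = 0)
           \<longrightarrow> (\<forall>i<k. \<forall>n. \<forall>z\<in>V. S i n z = 0)))"

text \<open>T induces, for every open V \<subseteq> U, an isomorphism of O_V-(a,b)-modules
  A~_V / A~_V P \<cong> E_phi(V), compatible with restrictions.\<close>
definition quot_iso :: "nat \<Rightarrow> (nat \<times> nat) set \<Rightarrow> pt set \<Rightarrow> (pt \<Rightarrow> nc) \<Rightarrow> (pt \<Rightarrow> xi)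
                        \<Rightarrow> ((pt \<Rightarrow> nc) \<Rightarrow> (pt \<Rightarrow> xi)) \<Rightarrow> bool" where
  "quot_iso k I V P \<phi> T \<longleftrightarrow>
     (\<forall>X\<in>ATU I V. T X \<in> Ephi k I V \<phi>) \<and>
     (\<forall>X\<in>ATU I V. \<forall>X'\<in>ATU I V. (\<forall>z\<in>V. T X z = T X' z) \<longleftrightarrow> congP I V P X X') \<and>
     (\<forall>\<Psi>\<in>Ephi k I V \<phi>. \<exists>X\<in>ATU I V. \<forall>z\<in>V. T X z = \<Psi> z) \<and>
     (\<forall>X\<in>ATU I V. \<forall>X'\<in>ATU I V. \<forall>z\<in>V. T (X + X') z = T X z + T X' z) \<and>
     (\<forall>S X. hol_fs I V S \<and> X \<in> ATU I V \<longrightarrow>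
        (\<forall>z\<in>V. T (\<lambda>w. ncmul (nc_ser (\<lambda>n. S n w)) (X w)) z = xi_smul (\<lambda>n. S n z) (T X z))) \<and>
     (\<forall>X\<in>ATU I V. \<forall>z\<in>V. T (\<lambda>w. ncmul nc_a (X w)) z = xi_a (T X z))"

definition canonical_family_holo_themes :: "nat \<Rightarrow> rat \<Rightarrow> (nat \<Rightarrow> nat) \<Rightarrow> bool" where
  "canonical_family_holo_themes k l1 p \<longleftrightarrow>
     (let I = Icoord k p in
      \<forall>\<sigma>0\<in>Sspace k p. \<exists>U. openS I U \<and> \<sigma>0 \<in> U \<and> U \<subseteq> Sspace k p \<and>
        (\<exists>(\<Lambda>::rat set) N \<phi> T. finite \<Lambda> \<and> \<Lambda> \<subseteq> {0<..1} \<and> thematic k I U \<Lambda> N \<phi> \<and>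
           (\<forall>V. openS I V \<and> V \<subseteq> U \<longrightarrow> quot_iso k I V (Pcan k l1 p) \<phi> T)))"

end

theory Submission
  imports Defs
begin

text \<open>
  Put \<open>\<phi>\<^sub>0 = 0\<close> and let \<open>\<phi>\<^sub>j\<^sub>+\<^sub>1\<close> solve \<open>(a - \<lambda>\<^sub>j\<^sub>+\<^sub>1 b) \<phi>\<^sub>j\<^sub>+\<^sub>1 = S\<^sub>j \<phi>\<^sub>j\<close> in \<open>\<Xi>\<close>, with \<open>S\<^sub>0 = 1\<close>; then \<open>P \<phi>\<^sub>k = 0\<close>.
  Solving is possible since \<open>\<lambda>\<^sub>1 > k - 1\<close> keeps \<open>\<phi>\<^sub>j\<close> divisible by \<open>b^(k-j)\<close>, and the solution depends
  polynomially on the parameters, so one \<open>\<phi>\<^sub>k\<close> serves the whole parameter space.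
  The \<open>(log s)^j\<close>-component of \<open>\<phi>\<^sub>j\<^sub>+\<^sub>1\<close> is a monomial in \<open>b\<close> whose coefficient is the product of the
  coefficients of \<open>b^(p\<^sub>i)\<close> in \<open>S\<^sub>i\<close>, hence nonzero. Dividing \<open>X = Y (a - \<lambda>\<^sub>j\<^sub>+\<^sub>1 b) + r(b)\<close> and comparing
  highest powers of the logarithm, \<open>X \<phi>\<^sub>j\<^sub>+\<^sub>1 = 0\<close> forces \<open>r = 0\<close> and \<open>Y S\<^sub>j \<phi>\<^sub>j = 0\<close>; by induction the
  annihilator of \<open>\<phi>\<^sub>k\<close> is the left ideal of \<open>P\<close>, and everything is holomorphic in the parameters because
  the division is given by polynomial formulas. Identities in the algebra are checked on \<open>\<Xi>\<close>,
  extended to all rational exponents, where the action is faithful.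
\<close>

section \<open>The action on formal logarithmic series\<close>

lemma sum_apply3: "(\<Sum>i\<in>A. f i) l m j = (\<Sum>i\<in>A. f i l m j)"
  for f :: "'i \<Rightarrow> 'a \<Rightarrow> 'b \<Rightarrow> 'c \<Rightarrow> complex"
  by (induction A rule: infinite_finite_induct) auto

definition xi_b :: "xi \<Rightarrow> xi" where
  "xi_b \<psi> l m j = (if m = 0 then 0 else \<psi> l (m - 1) j)"

definition xi_ab :: "nat \<Rightarrow> nat \<Rightarrow> xi \<Rightarrow> xi" where
  "xi_ab i n \<psi> = (xi_a ^^ i) ((xi_b ^^ n) \<psi>)"

text \<open>Since a and b each raise the order in b by at least one, a^i b^n reaches the coefficient
  of b^m only if i + n \<le> m. The cut-offs therefore discard nothing, and the sum is finite for
  every coefficient array.\<close>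

definition act :: "nc \<Rightarrow> xi \<Rightarrow> xi" where
  "act x \<psi> l m j = (\<Sum>n\<le>m. \<Sum>i\<le>m. x n i * xi_ab i n \<psi> l m j)"

lemma xi_b_pow: "(xi_b ^^ n) \<psi> l m j = (if m < n then 0 else \<psi> l (m - n) j)"
  by (induction n arbitrary: m) (auto simp: xi_b_def)

lemma xi_a_pow_sum:
  "(xi_a ^^ i) (\<lambda>l m j. \<Sum>q\<in>Q. c q * \<psi> q l m j) = (\<lambda>l m j. \<Sum>q\<in>Q. c q * (xi_a ^^ i) (\<psi> q) l m j)"
  by (induction i) (simp_all add: xi_a_def fun_eq_iff sum_distrib_left sum.distrib distrib_left mult.left_commute)

lemma xi_b_pow_sum:
  "(xi_b ^^ i) (\<lambda>l m j. \<Sum>q\<in>Q. c q * \<psi> q l m j) = (\<lambda>l m j. \<Sum>q\<in>Q. c q * (xi_b ^^ i) (\<psi> q) l m j)"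
  by (auto simp: xi_b_pow fun_eq_iff)

lemma xi_ab_sum:
  "xi_ab i n (\<lambda>l m j. \<Sum>q\<in>Q. c q * \<psi> q l m j) l m j = (\<Sum>q\<in>Q. c q * xi_ab i n (\<psi> q) l m j)"
  by (simp add: xi_ab_def xi_b_pow_sum xi_a_pow_sum)

lemma xi_a_pow_local:
  assumes "\<And>m j. m \<le> M \<Longrightarrow> \<psi> l m j = \<psi>' l m j" and "m \<le> M"
  shows "(xi_a ^^ i) \<psi> l m j = (xi_a ^^ i) \<psi>' l m j"
  using assms(2) by (induction i arbitrary: m j) (auto simp: xi_a_def assms(1))

lemma xi_ab_local:
  assumes "\<And>m j. m \<le> M \<Longrightarrow> \<psi> l m j = \<psi>' l m j" and "m \<le> M"
  shows "xi_ab i n \<psi> l m j = xi_ab i n \<psi>' l m j"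
  unfolding xi_ab_def
  by (rule xi_a_pow_local[of M]) (use assms in \<open>auto simp: xi_b_pow\<close>)

lemma xi_a_pow_order:
  assumes "\<And>m j. m < d \<Longrightarrow> \<psi> l m j = 0" and "m < d + i"
  shows "(xi_a ^^ i) \<psi> l m j = 0"
  using assms(2) by (induction i arbitrary: m j) (auto simp: xi_a_def assms(1))

lemma xi_ab_order: "m < i + n \<Longrightarrow> xi_ab i n \<psi> l m j = 0"
  unfolding xi_ab_def by (rule xi_a_pow_order[where d = n]) (auto simp: xi_b_pow)

lemma act_upto:
  assumes "m \<le> N" "m \<le> R"
  shows "act x \<psi> l m j = (\<Sum>n\<le>N. \<Sum>i\<le>R. x n i * xi_ab i n \<psi> l m j)"
proof -
  have "act x \<psi> l m j = (\<Sum>n\<le>m. \<Sum>i\<le>R. x n i * xi_ab i n \<psi> l m j)"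
    unfolding act_def using assms
    by (intro sum.cong refl sum.mono_neutral_left) (auto simp: xi_ab_order)
  also have "\<dots> = (\<Sum>n\<le>N. \<Sum>i\<le>R. x n i * xi_ab i n \<psi> l m j)"
    using assms by (intro sum.mono_neutral_left) (auto simp: xi_ab_order)
  finally show ?thesis .
qed

lemma xi_ab_Suc: "xi_ab (Suc i) n \<psi> = xi_a (xi_ab i n \<psi>)"
  by (simp add: xi_ab_def)

text \<open>This is b^n a = a b^n - n b^(n+1), written as a sum over two indices so that
  \<open>xi_a_pow_sum\<close> can carry it through powers of a.\<close>

lemma xi_b_pow_xi_a:
  "(xi_b ^^ n) (xi_a \<psi>) = (\<lambda>l m j. \<Sum>q\<in>{0, 1::nat}. (if q = 0 then 1 else - of_nat n) *
      (if q = 0 then xi_a ((xi_b ^^ n) \<psi>) else (xi_b ^^ Suc n) \<psi>) l m j)"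
  by (auto simp: fun_eq_iff xi_b_pow xi_a_def xi_b_def of_nat_diff algebra_simps)

lemma xi_ab_xi_a:
  "xi_ab i n (xi_a \<psi>) l m j = xi_ab (Suc i) n \<psi> l m j - of_nat n * xi_ab i (Suc n) \<psi> l m j"
  unfolding xi_ab_def xi_b_pow_xi_a xi_a_pow_sum by (simp add: funpow_swap1)

section \<open>Normal ordering and the action of a product\<close>

text \<open>With a and b of degree one the relation ab - ba = b^2 is homogeneous: normal ordering
  keeps the total degree and never raises the degree in a.\<close>

lemma bna_support: "bna n j m i \<noteq> 0 \<Longrightarrow> m + i = n + j \<and> i \<le> j"
proof (induction j arbitrary: m i)
  case (Suc j)
  have "(i \<noteq> 0 \<and> bna n j m (i - 1) \<noteq> 0) \<or> (m \<noteq> 0 \<and> bna n j (m - 1) i \<noteq> 0)"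
    using Suc.prems by (auto split: if_splits)
  then show ?case
    using Suc.IH[of m "i - 1"] Suc.IH[of "m - 1" i] by auto
qed (auto split: if_splits)

lemma bna_eq_0: "m + i \<noteq> n + j \<or> i > j \<Longrightarrow> bna n j m i = 0"
  using bna_support[of n j m i] by (metis not_le)

text \<open>The transposed recursion of \<open>bna\<close>: with G m i standing for a^i b^m, one
  more factor a on the right replaces it by the normal form of a^i b^m a.\<close>

lemma sum_bna_Suc:
  fixes G :: "nat \<Rightarrow> nat \<Rightarrow> complex"
  assumes "n + j \<le> K" "j \<le> R"
  shows "(\<Sum>m\<le>Suc K. \<Sum>i\<le>Suc R. bna n (Suc j) m i * G m i)
       = (\<Sum>m\<le>K. \<Sum>i\<le>R. bna n j m i * (G m (Suc i) - of_nat m * G (Suc m) i))"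
proof -
  have z1: "bna n j (Suc K) i = 0" "bna n j m (Suc R) = 0" for m i
    using assms by (auto intro!: bna_eq_0)
  have "(\<Sum>m\<le>Suc K. \<Sum>i\<le>Suc R. bna n (Suc j) m i * G m i)
      = (\<Sum>m\<le>Suc K. \<Sum>i\<le>Suc R. (if i = 0 then 0 else bna n j m (i - 1)) * G m i)
      - (\<Sum>m\<le>Suc K. \<Sum>i\<le>Suc R. (if m = 0 then 0 else of_nat (m - 1) * bna n j (m - 1) i) * G m i)"
    by (simp add: sum_subtractf algebra_simps del: sum.atMost_Suc)
  also have "(\<Sum>m\<le>Suc K. \<Sum>i\<le>Suc R. (if i = 0 then 0 else bna n j m (i - 1)) * G m i)
      = (\<Sum>m\<le>K. \<Sum>i\<le>R. bna n j m i * G m (Suc i))"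
    by (subst sum.atMost_Suc_shift, simp add: z1)
  also have "(\<Sum>m\<le>Suc K. \<Sum>i\<le>Suc R. (if m = 0 then 0 else of_nat (m - 1) * bna n j (m - 1) i) * G m i)
      = (\<Sum>m\<le>K. \<Sum>i\<le>R. bna n j m i * (of_nat m * G (Suc m) i))"
    by (subst (2) sum.atMost_Suc_shift) (simp add: z1 mult_ac)
  finally show ?thesis
    by (simp add: sum_subtractf algebra_simps)
qed

text \<open>Identifies \<open>bna\<close> as the normal-ordering coefficients on \<Xi>. The
  induction peels off the factor a next to the vector, whence the generalisation over
  \<psi>.\<close>

lemma xi_ab_mult:
  assumes "n + j \<le> K" "j \<le> R"
  shows "xi_ab i n ((xi_a ^^ j) \<psi>) l M t
       = (\<Sum>m\<le>K. \<Sum>i'\<le>R. bna n j m i' * xi_ab (i + i') m \<psi> l M t)"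
  using assms
proof (induction j arbitrary: \<psi> K R)
  case 0
  have "(\<Sum>i'\<le>R. bna n 0 m i' * xi_ab (i + i') m \<psi> l M t)
      = (if m = n then xi_ab i n \<psi> l M t else 0)" for m
    by (cases "m = n") (simp_all add: if_distrib[of "\<lambda>x. x * _"] cong: if_cong)
  then show ?case using 0 by simp
next
  case (Suc j)
  obtain K' R' where [simp]: "K = Suc K'" "R = Suc R'" and le: "n + j \<le> K'" "j \<le> R'"
    using Suc.prems by (cases K; cases R) auto
  have "xi_ab i n ((xi_a ^^ Suc j) \<psi>) l M t = xi_ab i n ((xi_a ^^ j) (xi_a \<psi>)) l M t"
    by (simp add: funpow_swap1)
  also have "\<dots> = (\<Sum>m\<le>K'. \<Sum>i'\<le>R'. bna n j m i' * xi_ab (i + i') m (xi_a \<psi>) l M t)"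
    using Suc.IH[OF le] .
  also have "\<dots> = (\<Sum>m\<le>K. \<Sum>i'\<le>R. bna n (Suc j) m i' * xi_ab (i + i') m \<psi> l M t)"
    using sum_bna_Suc[OF le, of "\<lambda>m i'. xi_ab (i + i') m \<psi> l M t"]
    by (simp add: xi_ab_xi_a)
  finally show ?case .
qed

lemma xi_ab_xi_b_pow: "xi_ab i n ((xi_b ^^ m) \<psi>) = xi_ab i (n + m) \<psi>"
  by (simp add: xi_ab_def funpow_add)

lemma sum_shift_trunc:
  fixes f :: "nat \<Rightarrow> nat \<Rightarrow> complex"
  assumes "\<And>m s. s > M \<Longrightarrow> f m s = 0" "M \<le> K"
  shows "(\<Sum>s\<le>M. if \<mu> \<le> s then f (s - \<mu>) s else 0) = (\<Sum>m\<le>K. f m (m + \<mu>))"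
proof -
  have "(\<Sum>s\<le>M. if \<mu> \<le> s then f (s - \<mu>) s else 0) = (\<Sum>s\<in>{\<mu>..K+\<mu>}. f (s - \<mu>) s)"
    using assms by (intro sum.mono_neutral_cong) auto
  also have "\<dots> = (\<Sum>m\<in>{0..K}. f m (m + \<mu>))"
    by (rule sum.reindex_bij_witness[of _ "\<lambda>m. m + \<mu>" "\<lambda>s. s - \<mu>"]) auto
  finally show ?thesis by (simp add: atMost_atLeast0)
qed

lemma sum_swap2:
  "(\<Sum>s\<in>A. \<Sum>r\<in>B. \<Sum>v\<in>C. f s r v) = (\<Sum>v\<in>C. \<Sum>s\<in>A. \<Sum>r\<in>B. f s r v)"
  by (subst sum.swap[of _ C B], subst sum.swap[of _ C A]) rule

theorem act_ncmul: "act (ncmul x y) \<psi> = act x (act y \<psi>)"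
proof (intro ext)
  fix l M t
  define G where "G s r = xi_ab r s \<psi> l M t" for s r
  have G0: "G s r = 0" if "r + s > M" for s r
    using that by (simp add: G_def xi_ab_order)
  \<comment> \<open>The contribution of a single pair of monomials; the guards stand in for
    subtraction on naturals.\<close>
  have inner: "(\<Sum>s\<le>M. \<Sum>r\<le>M. if \<mu> \<le> s \<and> i \<le> r then bna \<nu> j (s - \<mu>) (r - i) * G s r else 0)
      = xi_ab i \<nu> (xi_ab j \<mu> \<psi>) l M t" for \<nu> i \<mu> j
  proof -
    define K where "K = M + \<nu> + j"
    have "xi_ab i \<nu> (xi_ab j \<mu> \<psi>) l M t = (\<Sum>m\<le>K. \<Sum>i'\<le>K. bna \<nu> j m i' * G (m + \<mu>) (i' + i))"
      unfolding xi_ab_def[of j] by (subst xi_ab_mult[of _ _ K K])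
        (auto simp: K_def G_def xi_ab_xi_b_pow ac_simps)
    also have "\<dots> = (\<Sum>m\<le>K. \<Sum>r\<le>M. if i \<le> r then bna \<nu> j m (r - i) * G (m + \<mu>) r else 0)"
      by (intro sum.cong refl sum_shift_trunc[symmetric]) (auto simp: K_def G0)
    also have "\<dots> = (\<Sum>s\<le>M. if \<mu> \<le> s then (\<Sum>r\<le>M. if i \<le> r then bna \<nu> j (s - \<mu>) (r - i) * G s r else 0) else 0)"
      by (intro sum_shift_trunc[symmetric]) (auto simp: K_def G0 intro!: sum.neutral)
    also have "\<dots> = (\<Sum>s\<le>M. \<Sum>r\<le>M. if \<mu> \<le> s \<and> i \<le> r then bna \<nu> j (s - \<mu>) (r - i) * G s r else 0)"
      by (intro sum.cong refl) auto
    finally show ?thesis ..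
  qed
  \<comment> \<open>All ranges are made independent of s and r so that the sums can be interchanged.
    A nonzero \<open>bna\<close> forces j \<le> r + s and \<nu> \<le> s, so the added terms
    vanish.\<close>
  have nc: "ncmul x y s r = (\<Sum>\<nu>\<le>M. \<Sum>\<mu>\<le>M. \<Sum>i\<le>M. \<Sum>j\<le>2*M.
       if \<mu> \<le> s \<and> i \<le> r then x \<nu> i * y \<mu> j * bna \<nu> j (s - \<mu>) (r - i) else 0)" if "s \<le> M" "r \<le> M" for s r
  proof -
    have "ncmul x y s r = (\<Sum>\<nu>\<le>s. \<Sum>\<mu>\<le>s. \<Sum>i\<le>r. \<Sum>j\<le>r+s.
       if \<mu> \<le> s \<and> i \<le> r then x \<nu> i * y \<mu> j * bna \<nu> j (s - \<mu>) (r - i) else 0)"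
      by (auto simp: ncmul_def)
    also have "\<dots> = (\<Sum>\<nu>\<le>s. \<Sum>\<mu>\<le>s. \<Sum>i\<le>r. \<Sum>j\<le>2*M.
       if \<mu> \<le> s \<and> i \<le> r then x \<nu> i * y \<mu> j * bna \<nu> j (s - \<mu>) (r - i) else 0)"
      using that by (intro sum.cong refl sum.mono_neutral_left) (auto simp: bna_eq_0)
    also have "\<dots> = (\<Sum>\<nu>\<le>s. \<Sum>\<mu>\<le>s. \<Sum>i\<le>M. \<Sum>j\<le>2*M.
       if \<mu> \<le> s \<and> i \<le> r then x \<nu> i * y \<mu> j * bna \<nu> j (s - \<mu>) (r - i) else 0)"
      using that by (intro sum.cong refl sum.mono_neutral_left) auto
    also have "\<dots> = (\<Sum>\<nu>\<le>s. \<Sum>\<mu>\<le>M. \<Sum>i\<le>M. \<Sum>j\<le>2*M.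
       if \<mu> \<le> s \<and> i \<le> r then x \<nu> i * y \<mu> j * bna \<nu> j (s - \<mu>) (r - i) else 0)"
      using that by (intro sum.cong refl sum.mono_neutral_left) auto
    also have "\<dots> = (\<Sum>\<nu>\<le>M. \<Sum>\<mu>\<le>M. \<Sum>i\<le>M. \<Sum>j\<le>2*M.
       if \<mu> \<le> s \<and> i \<le> r then x \<nu> i * y \<mu> j * bna \<nu> j (s - \<mu>) (r - i) else 0)"
    proof (intro sum.mono_neutral_left)
      have "bna \<nu> j (s - \<mu>) (r - i) = 0" if "\<nu> > s" for \<nu> \<mu> i j
        using bna_support[of \<nu> j "s - \<mu>" "r - i"] that by force
      then show "\<forall>\<nu>\<in>{..M} - {..s}. (\<Sum>\<mu>\<le>M. \<Sum>i\<le>M. \<Sum>j\<le>2*M.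
       if \<mu> \<le> s \<and> i \<le> r then x \<nu> i * y \<mu> j * bna \<nu> j (s - \<mu>) (r - i) else 0) = 0"
        by (auto intro!: sum.neutral)
    qed (use that in auto)
    finally show ?thesis .
  qed
  have "act (ncmul x y) \<psi> l M t = (\<Sum>s\<le>M. \<Sum>r\<le>M. \<Sum>\<nu>\<le>M. \<Sum>\<mu>\<le>M. \<Sum>i\<le>M. \<Sum>j\<le>2*M.
       x \<nu> i * y \<mu> j * (if \<mu> \<le> s \<and> i \<le> r then bna \<nu> j (s - \<mu>) (r - i) * G s r else 0))"
    unfolding act_def
    by (intro sum.cong refl, subst nc)
      (auto simp: sum_distrib_right G_def if_distrib mult.assoc intro!: sum.cong)
  also have "\<dots> = (\<Sum>\<nu>\<le>M. \<Sum>\<mu>\<le>M. \<Sum>i\<le>M. \<Sum>j\<le>2*M. \<Sum>s\<le>M. \<Sum>r\<le>M.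
       x \<nu> i * y \<mu> j * (if \<mu> \<le> s \<and> i \<le> r then bna \<nu> j (s - \<mu>) (r - i) * G s r else 0))"
    by (subst sum_swap2, rule sum.cong[OF refl], subst sum_swap2, rule sum.cong[OF refl],
        subst sum_swap2, rule sum.cong[OF refl], subst sum_swap2, rule refl)
  also have "\<dots> = (\<Sum>\<nu>\<le>M. \<Sum>\<mu>\<le>M. \<Sum>i\<le>M. \<Sum>j\<le>2*M. x \<nu> i * y \<mu> j * xi_ab i \<nu> (xi_ab j \<mu> \<psi>) l M t)"
    by (simp only: sum_distrib_left[symmetric] inner)
  also have "\<dots> = (\<Sum>\<nu>\<le>M. \<Sum>i\<le>M. x \<nu> i * (\<Sum>\<mu>\<le>M. \<Sum>j\<le>2*M. y \<mu> j * xi_ab i \<nu> (xi_ab j \<mu> \<psi>) l M t))"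
    by (subst (2) sum.swap) (simp add: sum_distrib_left mult_ac)
  also have "\<dots> = (\<Sum>\<nu>\<le>M. \<Sum>i\<le>M. x \<nu> i * xi_ab i \<nu> (act y \<psi>) l M t)"
  proof (intro sum.cong refl arg_cong2[of _ _ _ _ "(*)"])
    fix \<nu> i
    \<comment> \<open>Only coefficients up to b^M matter, so \<open>act y \<psi>\<close> may be
      replaced by one finite sum, to which linearity applies.\<close>
    have "xi_ab i \<nu> (act y \<psi>) l M t
        = xi_ab i \<nu> (\<lambda>l m t. \<Sum>q\<in>{..M}\<times>{..2*M}. y (fst q) (snd q) * xi_ab (snd q) (fst q) \<psi> l m t) l M t"
      by (rule xi_ab_local[of M]) 
        (auto simp: act_upto[of _ M "2*M"] sum.cartesian_product case_prod_unfold)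
    then show "(\<Sum>\<mu>\<le>M. \<Sum>j\<le>2*M. y \<mu> j * xi_ab i \<nu> (xi_ab j \<mu> \<psi>) l M t) = xi_ab i \<nu> (act y \<psi>) l M t"
      by (simp add: xi_ab_sum sum.cartesian_product case_prod_unfold)
  qed
  finally show "act (ncmul x y) \<psi> l M t = act x (act y \<psi>) l M t"
    by (simp add: act_def)
qed

lemma act_add: "act (x + y) \<psi> = act x \<psi> + act y \<psi>"
  by (simp add: fun_eq_iff act_def distrib_right sum.distrib)

lemma act_diff: "act (x - y) \<psi> = act x \<psi> - act y \<psi>"
  by (simp add: fun_eq_iff act_def left_diff_distrib sum_subtractf)

lemma act_0: "act 0 \<psi> = 0"
  by (simp add: fun_eq_iff act_def)

lemma act_sum: "act (\<Sum>i\<in>A. x i) \<psi> = (\<Sum>i\<in>A. act (x i) \<psi>)"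
  by (induction A rule: infinite_finite_induct) (simp_all only: sum.infinite sum.empty sum.insert act_add act_0 not_False_eq_True)

text \<open>a can lower the power of the logarithm but never raise it, and b leaves it
  alone.\<close>

lemma xi_ab_log:
  assumes "\<And>m j. j \<ge> J \<Longrightarrow> \<psi> l m j = 0" and "j \<ge> J"
  shows "xi_ab i n \<psi> l m j = 0"
proof -
  have "(xi_a ^^ i) \<psi>' l m j = 0" if "\<And>m j. j \<ge> J \<Longrightarrow> \<psi>' l m j = 0" for \<psi>'
    using \<open>j \<ge> J\<close> by (induction i arbitrary: m j) (auto simp: xi_a_def that)
  then show ?thesis
    unfolding xi_ab_def by (auto simp: xi_b_pow assms(1))
qed

lemma act_log:
  assumes "\<And>m j. j \<ge> J \<Longrightarrow> \<psi> l m j = 0" and "j \<ge> J"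
  shows "act x \<psi> l m j = 0"
  unfolding act_def using xi_ab_log[of J \<psi> l j] assms by (intro sum.neutral ballI) simp

lemma act_zero_right: "act x 0 = 0"
  by (simp add: fun_eq_iff act_log[where J = 0])

definition nc_apow :: "nat \<Rightarrow> nc" where
  "nc_apow k n i = (if n = 0 \<and> i = k then 1 else 0)"

lemma act_nc_apow: "act (nc_apow k) \<psi> = (xi_a ^^ k) \<psi>"
proof (intro ext)
  fix l m j
  have "(\<Sum>i\<le>m + k. nc_apow k n i * xi_ab i n \<psi> l m j) = (if n = 0 then xi_ab k 0 \<psi> l m j else 0)" for n
    by (cases "n = 0") (simp_all add: nc_apow_def if_distrib[of "\<lambda>x. x * _"] cong: if_cong)
  then show "act (nc_apow k) \<psi> l m j = (xi_a ^^ k) \<psi> l m j"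
    by (subst act_upto[where N = m and R = "m + k"]) (simp_all add: xi_ab_def)
qed

lemma act_nc_a: "act nc_a = xi_a"
  using act_nc_apow[of 1] by (simp add: fun_eq_iff nc_a_def[abs_def] nc_apow_def[abs_def])

lemma act_nc_ser: "act (nc_ser S) = xi_smul S"
proof (intro ext)
  fix \<psi> l m j
  have "(\<Sum>i\<le>m. nc_ser S n i * xi_ab i n \<psi> l m j) = S n * xi_ab 0 n \<psi> l m j" for n
    by (simp add: nc_ser_def if_distrib[of "\<lambda>x. x * _"] cong: if_cong)
  then show "act (nc_ser S) \<psi> l m j = xi_smul S \<psi> l m j"
    by (auto simp: act_def xi_smul_def xi_ab_def xi_b_pow intro!: sum.cong)
qed

lemma act_nc_one: "act nc_one \<psi> = \<psi>"
  using act_nc_apow[of 0 \<psi>] by (simp add: nc_one_def[abs_def] nc_apow_def[abs_def] conj_commute)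

definition xi_d :: "complex \<Rightarrow> xi \<Rightarrow> xi" where
  "xi_d c \<psi> l m j = xi_a \<psi> l m j - c * xi_b \<psi> l m j"

lemma act_nc_a_minus_b: "act (\<lambda>n i. nc_a n i - c * nc_b n i) = xi_d c"
proof
  fix \<psi>
  have "(\<lambda>n i. nc_a n i - c * nc_b n i) = nc_a - nc_ser (\<lambda>n. if n = 1 then c else 0)"
    by (auto simp: fun_eq_iff nc_b_def nc_ser_def)
  then have "act (\<lambda>n i. nc_a n i - c * nc_b n i) \<psi> = xi_a \<psi> - xi_smul (\<lambda>n. if n = 1 then c else 0) \<psi>"
    by (simp add: act_diff act_nc_a act_nc_ser)
  also have "\<dots> = xi_d c \<psi>"
    by (auto simp: fun_eq_iff xi_d_def xi_smul_def xi_b_def if_distrib[of "\<lambda>x. x * _"] cong: if_cong)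
  finally show "act (\<lambda>n i. nc_a n i - c * nc_b n i) \<psi> = xi_d c \<psi>" .
qed

section \<open>Faithfulness of the action\<close>

definition xi_e :: "rat \<Rightarrow> xi" where
  "xi_e l0 l m j = (if l = l0 \<and> m = 0 \<and> j = 0 then 1 else 0)"

text \<open>Each a turns b^m e_(l,0) into (l + m) b^(m+1) e_(l,0). The zeros of the resulting rising
  factorial at suitable integers l drive the faithfulness arguments.\<close>

lemma xi_ab_e:
  "xi_ab i n (xi_e l) l m 0 = (if m = n + i then pochhammer (of_rat l + of_nat n) i else 0)"
proof (induction i arbitrary: m)
  case 0
  then show ?case by (auto simp: xi_ab_def xi_b_pow xi_e_def)
next
  case (Suc i)
  have "xi_ab i n (xi_e l) l m (Suc 0) = 0" for m
    by (rule xi_ab_log[where J = 1]) (auto simp: xi_e_def)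
  then show ?case
    by (auto simp: xi_ab_Suc xi_a_def Suc pochhammer_Suc algebra_simps)
qed

text \<open>On \<open>e\<^bsub>l,0\<^esub>\<close> with \<open>l = n + 1 - M\<close> the monomials \<open>a^i b^(M-i)\<close> with \<open>i > n\<close> vanish,
  so the coefficients of total degree \<open>M\<close> can be read off one at a time.\<close>

lemma act_eq_0_imp:
  assumes "\<And>\<psi>. act x \<psi> = 0"
  shows "x = 0"
proof -
  have "n \<le> M \<longrightarrow> x (M - n) n = 0" for M n
  proof (induction n rule: less_induct)
    case (less n)
    show ?case
    proof
      assume n: "n \<le> M"
      define l :: rat where "l = of_nat (n + 1) - of_nat M"
      have eq: "of_rat l + of_nat (M - i) = (of_nat (n + 1) - of_nat i :: complex)" if "i \<le> M" for i
        using that by (simp add: l_def of_rat_diff of_rat_add of_nat_diff)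
      have poch: "pochhammer (of_nat (n + 1) - of_nat i :: complex) i = 0 \<longleftrightarrow> i > n" for i
      proof (cases "i > n")
        case True
        then have "of_nat (n + 1) - of_nat i = (- of_nat (i - (n + 1)) :: complex)"
          by (simp add: of_nat_diff)
        then show ?thesis using True by (simp only: pochhammer_of_nat_eq_0_iff) auto
      next
        case False
        then have "of_nat (n + 1) - of_nat i = (of_nat (n + 1 - i) :: complex)"
          by (simp add: of_nat_diff)
        moreover have "pochhammer (n + 1 - i) i > 0"
          using False by (intro pochhammer_pos) auto
        ultimately show ?thesis
          using False by (simp only: pochhammer_of_nat of_nat_eq_0_iff) simp
      qed
      have "0 = act x (xi_e l) l M 0"
        using assms[of "xi_e l"] by simp
      also have "\<dots> = (\<Sum>i\<le>M. \<Sum>\<nu>\<le>M. if \<nu> = M - i then x \<nu> i * pochhammer (of_rat l + of_nat \<nu>) i else 0)"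
        unfolding act_def by (subst sum.swap) (auto simp: xi_ab_e intro!: sum.cong)
      also have "\<dots> = (\<Sum>i\<le>M. x (M - i) i * pochhammer (of_rat l + of_nat (M - i)) i)"
        by simp
      also have "\<dots> = (\<Sum>i\<le>M. if i = n then x (M - n) n * pochhammer (of_nat (n + 1) - of_nat n) n else 0)"
      proof (intro sum.cong refl)
        fix i assume i: "i \<in> {..M}"
        have *: "pochhammer (of_rat l + of_nat (M - i)) i = (pochhammer (of_nat (n + 1) - of_nat i) i :: complex)"
          using i by (simp only: eq atMost_iff)
        consider "i < n" | "i = n" | "i > n" by linarith
        then show "x (M - i) i * pochhammer (of_rat l + of_nat (M - i)) i
          = (if i = n then x (M - n) n * pochhammer (of_nat (n + 1) - of_nat n) n else 0)"
          unfolding * using less.IH[of i] i n poch[of i] by cases auto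
      qed
      also have "\<dots> = x (M - n) n * pochhammer (of_nat (n + 1) - of_nat n) n"
        using n by simp
      finally show "x (M - n) n = 0"
        using poch[of n] by simp
    qed
  qed
  from this[of i "n + i" for n i] show ?thesis
    by (simp add: fun_eq_iff)
qed

lemma act_inject:
  assumes "\<And>\<psi>. act x \<psi> = act y \<psi>"
  shows "x = y"
  using act_eq_0_imp[of "x - y"] assms by (simp add: act_diff)

text \<open>At l = -n the powers a^i with i > n kill e_(l,0), the terms with i < n are gone by
  induction, and a^n gives a nonzero multiple of b^n e_(l,0); so T_n can be read off.\<close>

lemma left_form_eq_0_imp:
  assumes "\<And>\<psi>. (\<Sum>i<k. xi_smul (T i) ((xi_a ^^ i) \<psi>)) = 0" and "n < k"
  shows "T n = (\<lambda>_. 0)"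
  using \<open>n < k\<close>
proof (induction n rule: less_induct)
  case (less n)
  have "T n m = 0" for m
  proof -
    define l :: rat where "l = - of_nat n"
    have *: "xi_smul (T i) ((xi_a ^^ i) (xi_e l)) l (n + m) 0
       = (if i = n then T n m * pochhammer (- of_nat n) n else 0)" for i
    proof -
      have "xi_smul (T i) ((xi_a ^^ i) (xi_e l)) l (n + m) 0
          = (\<Sum>t\<le>n+m. T i t * (if n + m - t = i then pochhammer (- of_nat n) i else 0))"
        using xi_ab_e[of i 0 l, unfolded xi_ab_def]
        by (simp add: xi_smul_def) (simp add: l_def of_rat_minus cong: if_cong)
      also have "\<dots> = (if i = n then T n m * pochhammer (- of_nat n) n else 0)"
      proof (cases i n rule: linorder_cases)
        case greater
        then show ?thesis by (auto simp: pochhammer_of_nat_eq_0_iff intro!: sum.neutral)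
      next
        case equal
        have "(\<Sum>t\<le>n+m. T n t * (if n + m - t = n then pochhammer (- of_nat n) n else 0))
            = (\<Sum>t\<le>n+m. if t = m then T n t * pochhammer (- of_nat n) n else 0)"
          by (intro sum.cong) auto
        then show ?thesis using equal by (simp cong: if_cong)
      next
        case less
        then show ?thesis using less.IH[of i] \<open>n < k\<close> by simp
      qed
      finally show ?thesis .
    qed
    have "0 = (\<Sum>i<k. xi_smul (T i) ((xi_a ^^ i) (xi_e l))) l (n + m) 0"
      by (simp add: assms(1))
    also have "\<dots> = T n m * pochhammer (- of_nat n) n"
      using \<open>n < k\<close> by (simp add: sum_apply3 *)
    finally show ?thesis
      by (simp add: pochhammer_of_nat_eq_0_iff)
  qed
  then show ?case by blast
qed

section \<open>Degree in a and right division by a - c b\<close>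

text \<open>The bounds are assumed only up to b^s, which is all that this coefficient sees: in the
  algebra the degree in a may grow with the power of b.\<close>

lemma ncmul_degree:
  assumes "\<And>\<nu> i. \<nu> \<le> s \<Longrightarrow> i \<ge> d \<Longrightarrow> x \<nu> i = 0" "\<And>\<mu> j. \<mu> \<le> s \<Longrightarrow> j > e \<Longrightarrow> y \<mu> j = 0"
    and "r \<ge> d + e"
  shows "ncmul x y s r = 0"
proof -
  have "x \<nu> i * y \<mu> j * bna \<nu> j (s - \<mu>) (r - i) = 0" if "\<nu> \<le> s" "\<mu> \<le> s" for \<nu> \<mu> i j
  proof (cases "i \<ge> d \<or> j > e")
    case False
    then have "r - i > j" using assms(3) by auto
    then show ?thesis by (simp add: bna_eq_0)
  qed (use assms that in auto)
  then show ?thesis unfolding ncmul_def by (intro sum.neutral ballI) simp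
qed

text \<open>The recursion comes from \<open>a^i b^n (a - c b) = a^(i+1) b^n - (c + n) a^i b^(n+1)\<close>.\<close>

fun div_quot :: "complex \<Rightarrow> nc \<Rightarrow> nc" where
  "div_quot c x 0 i = x 0 (Suc i)"
| "div_quot c x (Suc n) i = x (Suc n) (Suc i) + (c + of_nat n) * div_quot c x n (Suc i)"

text \<open>The recursion of \<open>div_quot\<close> continued to the exponent -1 of a.\<close>

definition div_rem :: "complex \<Rightarrow> nc \<Rightarrow> nat \<Rightarrow> complex" where
  "div_rem c x n = x n 0 + (if n = 0 then 0 else (c + of_nat (n - 1)) * div_quot c x (n - 1) 0)"

lemma xi_ab_xi_d:
  "xi_ab i n (xi_d c \<psi>) l m j = xi_ab (Suc i) n \<psi> l m j - (c + of_nat n) * xi_ab i (Suc n) \<psi> l m j"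
proof -
  have "xi_d c \<psi> = (\<lambda>l m j. \<Sum>q\<in>{0,1::nat}. (if q = 0 then 1 else - c) * (if q = 0 then xi_a \<psi> else xi_b \<psi>) l m j)"
    by (simp add: fun_eq_iff xi_d_def)
  then have "xi_ab i n (xi_d c \<psi>) l m j = xi_ab i n (xi_a \<psi>) l m j - c * xi_ab i n (xi_b \<psi>) l m j"
    by (simp only: xi_ab_sum) simp
  then show ?thesis
    using xi_ab_xi_b_pow[of i n 1 \<psi>] by (simp add: xi_ab_xi_a algebra_simps)
qed

text \<open>Right division x = q (a - c b) + r(b) by a divisor monic in a. The defining recursions
  are solved for the coefficients of x, and a shift of the index of b regroups the series.\<close>

theorem act_div:
  "act x \<psi> = act (div_quot c x) (xi_d c \<psi>) + xi_smul (div_rem c x) \<psi>"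
proof (intro ext)
  fix l M t
  define G where "G n i = xi_ab i n \<psi> l M t" for n i
  define q where "q = div_quot c x"
  have G0: "G n i = 0" if "n + i > M" for n i
    using that by (simp add: G_def xi_ab_order)
  have x1: "x n (Suc i) = q n i - (if n = 0 then 0 else (c + of_nat (n - 1)) * q (n - 1) (Suc i))" for n i
    by (cases n) (simp_all add: q_def)
  have x0: "x n 0 = div_rem c x n - (if n = 0 then 0 else (c + of_nat (n - 1)) * q (n - 1) 0)" for n
    by (simp add: div_rem_def q_def)
  have "(\<Sum>i\<le>Suc M. x n i * G n i) = div_rem c x n * G n 0 + (\<Sum>i\<le>M. q n i * G n (Suc i))
     - (if n = 0 then 0 else (c + of_nat (n - 1)) * (\<Sum>i\<le>Suc M. q (n - 1) i * G n i))" for n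
    unfolding sum.atMost_Suc_shift x0 x1
    by (simp add: algebra_simps sum_subtractf sum_distrib_left)
  then have "act x \<psi> l M t = (\<Sum>n\<le>Suc M. div_rem c x n * G n 0) + (\<Sum>n\<le>Suc M. \<Sum>i\<le>M. q n i * G n (Suc i))
     - (\<Sum>n\<le>Suc M. if n = 0 then 0 else (c + of_nat (n - 1)) * (\<Sum>i\<le>Suc M. q (n - 1) i * G n i))"
    by (simp add: act_upto[of M "Suc M" "Suc M"] G_def[symmetric] sum.distrib sum_subtractf del: sum.atMost_Suc)
  also have "(\<Sum>n\<le>Suc M. if n = 0 then 0 else (c + of_nat (n - 1)) * (\<Sum>i\<le>Suc M. q (n - 1) i * G n i))
     = (\<Sum>n\<le>M. \<Sum>i\<le>M. q n i * ((c + of_nat n) * G (Suc n) i))"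
    by (subst sum.atMost_Suc_shift) (simp add: G0 sum_distrib_left algebra_simps)
  also have "(\<Sum>n\<le>Suc M. div_rem c x n * G n 0) = (\<Sum>n\<le>M. div_rem c x n * G n 0)"
    by (simp add: G0)
  also have "(\<Sum>n\<le>Suc M. \<Sum>i\<le>M. q n i * G n (Suc i)) = (\<Sum>n\<le>M. \<Sum>i\<le>M. q n i * G n (Suc i))"
    by (simp add: G0)
  also have "(\<Sum>n\<le>M. div_rem c x n * G n 0) = xi_smul (div_rem c x) \<psi> l M t"
    by (auto simp: xi_smul_def G_def xi_ab_def xi_b_pow intro!: sum.cong)
  finally show "act x \<psi> l M t = (act (div_quot c x) (xi_d c \<psi>) + xi_smul (div_rem c x) \<psi>) l M t"
    by (simp add: act_def xi_ab_xi_d G_def q_def sum_subtractf algebra_simps)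
qed

lemma div_quot_degree:
  assumes "\<And>n i. i \<ge> Suc d \<Longrightarrow> x n i = 0" and "i \<ge> d"
  shows "div_quot c x n i = 0"
  using assms(2) by (induction n arbitrary: i) (auto simp: assms(1))

lemma xi_smul_fps:
  "xi_smul S \<psi> l m j = fps_nth (Abs_fps S * Abs_fps (\<lambda>m. \<psi> l m j)) m"
  by (simp add: xi_smul_def fps_mult_nth atMost_atLeast0)

lemma xi_smul_xi_smul:
  "xi_smul S (xi_smul T \<psi>) = xi_smul (\<lambda>n. \<Sum>i\<le>n. S i * T (n - i)) \<psi>"
proof (intro ext)
  fix l m j
  have "Abs_fps (\<lambda>n. \<Sum>i\<le>n. S i * T (n - i)) = Abs_fps S * Abs_fps T"
    by (simp add: fps_eq_iff fps_mult_nth atMost_atLeast0)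
  moreover have "Abs_fps (\<lambda>m. xi_smul T \<psi> l m j) = Abs_fps T * Abs_fps (\<lambda>m. \<psi> l m j)"
    by (simp add: xi_smul_fps fps_eq_iff)
  ultimately show "xi_smul S (xi_smul T \<psi>) l m j = xi_smul (\<lambda>n. \<Sum>i\<le>n. S i * T (n - i)) \<psi> l m j"
    by (simp add: xi_smul_fps[of S] xi_smul_fps[of "\<lambda>n. \<Sum>i\<le>n. S i * T (n - i)"] mult.assoc)
qed

lemma xi_smul_one: "xi_smul (fps_nth 1) \<psi> = \<psi>"
  by (simp add: fun_eq_iff xi_smul_fps fps_nth_inverse)

lemma xi_smul_fps_mult: "xi_smul (fps_nth f) (xi_smul (fps_nth g) \<psi>) = xi_smul (fps_nth (f * g)) \<psi>"
  by (simp add: xi_smul_xi_smul fps_mult_nth[abs_def] atMost_atLeast0)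

lemma xi_smul_add_right: "xi_smul S (\<psi> + \<psi>') = xi_smul S \<psi> + xi_smul S \<psi>'"
  by (simp add: fun_eq_iff xi_smul_def sum.distrib distrib_left)

lemma xi_smul_add_left: "xi_smul (\<lambda>n. S n + T n) \<psi> = xi_smul S \<psi> + xi_smul T \<psi>"
  by (simp add: fun_eq_iff xi_smul_def sum.distrib distrib_right)

lemma xi_smul_zero: "xi_smul (\<lambda>_. 0) \<psi> = 0" "xi_smul S 0 = 0"
  by (simp_all add: fun_eq_iff xi_smul_def)

lemma xi_smul_sum: "xi_smul S (\<Sum>i\<in>A. \<psi> i) = (\<Sum>i\<in>A. xi_smul S (\<psi> i))"
  by (induction A rule: infinite_finite_induct) (simp_all only: sum.infinite sum.empty sum.insert xi_smul_add_right xi_smul_zero not_False_eq_True)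

lemma xi_a_add: "xi_a (\<psi> + \<psi>') = xi_a \<psi> + xi_a \<psi>'"
  by (simp add: fun_eq_iff xi_a_def algebra_simps)

lemma xi_a_zero: "xi_a 0 = 0"
  by (simp add: fun_eq_iff xi_a_def)

lemma xi_a_sum: "xi_a (\<Sum>i\<in>A. \<psi> i) = (\<Sum>i\<in>A. xi_a (\<psi> i))"
  by (induction A rule: infinite_finite_induct) (simp_all only: sum.infinite sum.empty sum.insert xi_a_add xi_a_zero not_False_eq_True)

text \<open>Coefficients of \<open>b^2 S'(b)\<close>.\<close>
definition bb_deriv :: "(nat \<Rightarrow> complex) \<Rightarrow> nat \<Rightarrow> complex" where
  "bb_deriv S n = (if n = 0 then 0 else of_nat (n - 1) * S (n - 1))"

lemma xi_a_xi_smul: "xi_a (xi_smul S \<psi>) = xi_smul S (xi_a \<psi>) + xi_smul (bb_deriv S) \<psi>"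
proof (intro ext)
  fix l m j
  show "xi_a (xi_smul S \<psi>) l m j = (xi_smul S (xi_a \<psi>) + xi_smul (bb_deriv S) \<psi>) l m j"
  proof (cases m)
    case 0
    then show ?thesis by (simp add: xi_a_def xi_smul_def bb_deriv_def)
  next
    case (Suc M)
    have "xi_smul S (xi_a \<psi>) l (Suc M) j = (\<Sum>n\<le>M. S n * xi_a \<psi> l (Suc M - n) j)"
      by (simp add: xi_smul_def xi_a_def)
    also have "\<dots> = (\<Sum>n\<le>M. S n * ((of_rat l + of_nat M - of_nat n) * \<psi> l (M - n) j + \<psi> l (M - n) (Suc j)))"
      by (intro sum.cong refl) (auto simp: xi_a_def Suc_diff_le of_nat_diff)
    finally have 1: "xi_smul S (xi_a \<psi>) l (Suc M) j = \<dots>" .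
    have 2: "xi_smul (bb_deriv S) \<psi> l (Suc M) j = (\<Sum>n\<le>M. of_nat n * S n * \<psi> l (M - n) j)"
      unfolding xi_smul_def by (subst sum.atMost_Suc_shift) (simp add: bb_deriv_def)
    show ?thesis
      by (simp add: Suc 1 2 xi_a_def[of "xi_smul S \<psi>"] xi_smul_def[of S \<psi>] sum_distrib_left sum.distrib[symmetric]
        algebra_simps)
  qed
qed

text \<open>\<open>nc\<close> stores b to the right of a, whereas module coefficients in b stand on
  the left; \<open>ncmul\<close> converts between the two.\<close>

definition nc_left_form :: "nat \<Rightarrow> (nat \<Rightarrow> nat \<Rightarrow> complex) \<Rightarrow> nc" where
  "nc_left_form k T = (\<Sum>i<k. ncmul (nc_ser (T i)) (nc_apow i))"

lemma act_nc_left_form: "act (nc_left_form k T) \<psi> = (\<Sum>i<k. xi_smul (T i) ((xi_a ^^ i) \<psi>))"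
  by (simp add: nc_left_form_def act_sum act_ncmul act_nc_ser act_nc_apow)

lemma sum_apply2: "(\<Sum>i\<in>A. f i) m j = (\<Sum>i\<in>A. f i m j)"
  for f :: "'i \<Rightarrow> 'a \<Rightarrow> 'b \<Rightarrow> complex"
  by (induction A rule: infinite_finite_induct) auto

lemma nc_left_form_degree: "r \<ge> k \<Longrightarrow> nc_left_form k T s r = 0"
  using ncmul_degree[of s 1 "nc_ser (T i)" i "nc_apow i" r for i]
  by (auto simp: nc_left_form_def sum_apply2 nc_ser_def nc_apow_def intro!: sum.neutral)

section \<open>Holomorphic dependence on parameters\<close>

lemma holo_on_const: "holo_on I V (\<lambda>_. c)"
  by (simp add: holo_on_def)

lemma holo_on_coord: "holo_on I V (\<lambda>z. z c)"
proof -
  have "(\<lambda>w. (z(d := w)) c) field_differentiable F" for z :: pt and d F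
    by (cases "c = d") (simp_all add: field_differentiable_ident)
  then show ?thesis
    by (auto simp: holo_on_def intro: continuous_on_subset[OF continuous_on_product_coordinates])
qed

lemma holo_on_add: "holo_on I V f \<Longrightarrow> holo_on I V g \<Longrightarrow> holo_on I V (\<lambda>z. f z + g z)"
  by (auto simp: holo_on_def intro!: continuous_on_add field_differentiable_add)

lemma holo_on_mult: "holo_on I V f \<Longrightarrow> holo_on I V g \<Longrightarrow> holo_on I V (\<lambda>z. f z * g z)"
  by (auto simp: holo_on_def intro!: continuous_on_mult field_differentiable_mult)

lemma holo_on_uminus: "holo_on I V f \<Longrightarrow> holo_on I V (\<lambda>z. - f z)"
  using holo_on_mult[OF holo_on_const[of I V "- 1"], of f] by simp

lemma holo_on_diff: "holo_on I V f \<Longrightarrow> holo_on I V g \<Longrightarrow> holo_on I V (\<lambda>z. f z - g z)"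
  using holo_on_add[OF _ holo_on_uminus, of I V f g] by simp

lemma holo_on_divide_const: "holo_on I V f \<Longrightarrow> holo_on I V (\<lambda>z. f z / c)"
  using holo_on_mult[OF _ holo_on_const[of I V "inverse c"], of f] by (simp add: divide_inverse)

lemma holo_on_sum: "(\<And>i. i \<in> A \<Longrightarrow> holo_on I V (f i)) \<Longrightarrow> holo_on I V (\<lambda>z. \<Sum>i\<in>A. f i z)"
  by (induction A rule: infinite_finite_induct) (auto intro: holo_on_const holo_on_add)

lemma holo_on_if: "(P \<Longrightarrow> holo_on I V f) \<Longrightarrow> (\<not> P \<Longrightarrow> holo_on I V g) \<Longrightarrow> holo_on I V (\<lambda>z. if P then f z else g z)"
  by (cases P) simp_all

lemmas holo_on_intros = holo_on_const holo_on_coord holo_on_add holo_on_mult holo_on_uminus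
  holo_on_diff holo_on_divide_const holo_on_sum holo_on_if

text \<open>With constant term 1 the recursion for the inverse involves no division.\<close>

lemma holo_on_fps_inverse:
  assumes "\<And>n. holo_on I V (\<lambda>z. fps_nth (f z) n)" "\<And>z. fps_nth (f z) 0 = 1"
  shows "holo_on I V (\<lambda>z. fps_nth (inverse (f z)) n)"
proof (induction n rule: less_induct)
  case (less n)
  show ?case
  proof (cases n)
    case 0
    then show ?thesis by (simp add: assms(2) holo_on_const)
  next
    case (Suc m)
    then have "fps_nth (inverse (f z)) n = - (\<Sum>i=1..n. fps_nth (f z) i * fps_nth (inverse (f z)) (n - i))" for z
      by (simp add: fps_inverse_def assms(2))
    then show ?thesis
      by (auto intro!: holo_on_intros assms less.IH)
  qed
qed

section \<open>Sections of the sheaf of algebras\<close>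

lemma holo_on_ncmul:
  assumes "\<And>n i. holo_on I V (\<lambda>z. X z n i)" "\<And>n i. holo_on I V (\<lambda>z. Y z n i)"
  shows "holo_on I V (\<lambda>z. ncmul (X z) (Y z) n i)"
  unfolding ncmul_def by (intro holo_on_intros assms)

text \<open>The degree bounds in \<open>ATU\<close> vary with the power of b; finitely many powers
  admit a common bound, which suffices for one coefficient of a product.\<close>

lemma ATU_degree_upto:
  assumes "X \<in> ATU I V"
  shows "\<exists>d. \<forall>n i z. n \<le> s \<longrightarrow> i \<ge> d \<longrightarrow> z \<in> V \<longrightarrow> X z n i = 0"
proof -
  obtain D where D: "\<And>n i z. i > D n \<Longrightarrow> z \<in> V \<Longrightarrow> X z n i = 0"
    using assms unfolding ATU_def by simp metis
  have "X z n i = 0" if "n \<le> s" "i \<ge> Suc (\<Sum>n\<le>s. D n)" "z \<in> V" for n i z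
    using member_le_sum[of n "{..s}" D] that by (intro D) auto
  then show ?thesis by blast
qed

lemma ATU_ncmul:
  assumes "X \<in> ATU I V" "Y \<in> ATU I V"
  shows "(\<lambda>z. ncmul (X z) (Y z)) \<in> ATU I V"
proof -
  have "\<exists>d. \<forall>i>d. \<forall>z\<in>V. ncmul (X z) (Y z) s i = 0" for s
  proof -
    obtain d where d: "\<And>n i z. n \<le> s \<Longrightarrow> i \<ge> d \<Longrightarrow> z \<in> V \<Longrightarrow> X z n i = 0"
      using ATU_degree_upto[OF assms(1), of s] by blast
    obtain e where e: "\<And>n i z. n \<le> s \<Longrightarrow> i \<ge> e \<Longrightarrow> z \<in> V \<Longrightarrow> Y z n i = 0"
      using ATU_degree_upto[OF assms(2), of s] by blast
    have "ncmul (X z) (Y z) s i = 0" if "i > d + e" "z \<in> V" for i z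
      by (rule ncmul_degree[where d = d and e = e]) (use d e that in auto)
    then show ?thesis by blast
  qed
  then show ?thesis
    using assms by (simp add: ATU_def holo_on_ncmul)
qed

lemma ATU_nc_ser: "hol_fs I V S \<Longrightarrow> (\<lambda>z. nc_ser (\<lambda>n. S n z)) \<in> ATU I V"
  by (auto simp: ATU_def hol_fs_def nc_ser_def intro!: holo_on_intros)

lemma ATU_nc_apow: "(\<lambda>z. nc_apow k) \<in> ATU I V"
  by (auto simp: ATU_def nc_apow_def holo_on_const intro!: exI[of _ k])

lemma ATU_diff:
  assumes "X \<in> ATU I V" "Y \<in> ATU I V"
  shows "(\<lambda>z. X z - Y z) \<in> ATU I V"
proof -
  have "\<exists>d. \<forall>i>d. \<forall>z\<in>V. X z s i - Y z s i = 0" for s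
  proof -
    obtain d where "\<And>n i z. n \<le> s \<Longrightarrow> i \<ge> d \<Longrightarrow> z \<in> V \<Longrightarrow> X z n i = 0"
      using ATU_degree_upto[OF assms(1), of s] by blast
    moreover obtain e where "\<And>n i z. n \<le> s \<Longrightarrow> i \<ge> e \<Longrightarrow> z \<in> V \<Longrightarrow> Y z n i = 0"
      using ATU_degree_upto[OF assms(2), of s] by blast
    ultimately show ?thesis by (intro exI[of _ "d + e"]) auto
  qed
  then show ?thesis
    using assms by (simp add: ATU_def holo_on_diff)
qed

lemma ATU_add:
  assumes "X \<in> ATU I V" "Y \<in> ATU I V"
  shows "(\<lambda>z. X z + Y z) \<in> ATU I V"
  using ATU_diff[OF assms(1) ATU_diff[OF ATU_diff[OF assms(1) assms(1)] assms(2)]] by simp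

lemma ATU_0: "(\<lambda>z. 0) \<in> ATU I V"
  by (simp add: ATU_def holo_on_const)

lemma ATU_sum: "(\<And>i. i \<in> A \<Longrightarrow> X i \<in> ATU I V) \<Longrightarrow> (\<lambda>z. \<Sum>i\<in>A. X i z) \<in> ATU I V"
  by (induction A rule: infinite_finite_induct)
    (auto simp only: sum.infinite sum.empty sum.insert not_False_eq_True intro!: ATU_add ATU_0)

lemma ATU_nc_left_form:
  assumes "\<And>i. i < k \<Longrightarrow> hol_fs I V (T i)"
  shows "(\<lambda>z. nc_left_form k (\<lambda>i n. T i n z)) \<in> ATU I V"
  unfolding nc_left_form_def
  by (intro ATU_sum ATU_ncmul ATU_nc_ser ATU_nc_apow assms) auto

lemma holo_on_div_quot:
  assumes "\<And>n i. holo_on I V (\<lambda>z. X z n i)"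
  shows "holo_on I V (\<lambda>z. div_quot c (X z) n i)"
  by (induction n arbitrary: i) (auto intro!: holo_on_intros assms)

lemma ATU_div_quot:
  assumes "X \<in> ATU I V"
  shows "(\<lambda>z. div_quot c (X z)) \<in> ATU I V"
proof -
  have deg: "div_quot c (X z) s i = 0" if "\<And>n i. n \<le> s \<Longrightarrow> i \<ge> d \<Longrightarrow> X z n i = 0" "i \<ge> d" for z s i d
    using that by (induction s arbitrary: i) auto
  have "\<exists>d. \<forall>i>d. \<forall>z\<in>V. div_quot c (X z) s i = 0" for s
  proof -
    obtain d where d: "\<And>n i z. n \<le> s \<Longrightarrow> i \<ge> d \<Longrightarrow> z \<in> V \<Longrightarrow> X z n i = 0"
      using ATU_degree_upto[OF assms, of s] by blast
    then show ?thesis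
      by (intro exI[of _ d] allI impI ballI deg[where d = d]) auto
  qed
  then show ?thesis
    using assms by (simp add: ATU_def holo_on_div_quot)
qed

lemma hol_fs_div_rem:
  assumes "X \<in> ATU I V"
  shows "hol_fs I V (\<lambda>n z. div_rem c (X z) n)"
  using assms unfolding hol_fs_def div_rem_def
  by (auto simp: ATU_def intro!: holo_on_intros holo_on_div_quot)

section \<open>Holomorphic left combinations of powers of a\<close>

text \<open>Kept as operators on all vectors rather than evaluated at one, so that they can be
  composed with further operators.\<close>

definition left_form :: "(nat \<times> nat) set \<Rightarrow> pt set \<Rightarrow> nat \<Rightarrow> (pt \<Rightarrow> xi \<Rightarrow> xi) \<Rightarrow> bool" where
  "left_form I V d F \<longleftrightarrow> (\<exists>T :: nat \<Rightarrow> fs. (\<forall>i<d. hol_fs I V (T i)) \<and>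
     (\<forall>z\<in>V. \<forall>\<psi>. F z \<psi> = (\<Sum>i<d. xi_smul (\<lambda>n. T i n z) ((xi_a ^^ i) \<psi>))))"

lemma left_form_add:
  assumes "left_form I V d F" "left_form I V d G"
  shows "left_form I V d (\<lambda>z \<psi>. F z \<psi> + G z \<psi>)"
proof -
  obtain S where S: "\<forall>i<d. hol_fs I V (S i)"
    "\<forall>z\<in>V. \<forall>\<psi>. F z \<psi> = (\<Sum>i<d. xi_smul (\<lambda>n. S i n z) ((xi_a ^^ i) \<psi>))"
    using assms(1) unfolding left_form_def by blast
  obtain T where T: "\<forall>i<d. hol_fs I V (T i)"
    "\<forall>z\<in>V. \<forall>\<psi>. G z \<psi> = (\<Sum>i<d. xi_smul (\<lambda>n. T i n z) ((xi_a ^^ i) \<psi>))"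
    using assms(2) unfolding left_form_def by blast
  show ?thesis
    unfolding left_form_def
    by (rule exI[of _ "\<lambda>i n z. S i n z + T i n z"])
      (use S T in \<open>simp add: xi_smul_add_left sum.distrib hol_fs_def holo_on_add\<close>)
qed

lemma left_form_mono:
  assumes "left_form I V d F" "d \<le> e"
  shows "left_form I V e F"
proof -
  obtain S where S: "\<forall>i<d. hol_fs I V (S i)"
    "\<forall>z\<in>V. \<forall>\<psi>. F z \<psi> = (\<Sum>i<d. xi_smul (\<lambda>n. S i n z) ((xi_a ^^ i) \<psi>))"
    using assms(1) unfolding left_form_def by blast
  have "(\<Sum>i<d. xi_smul (\<lambda>n. S i n z) ((xi_a ^^ i) \<psi>))
      = (\<Sum>i<e. xi_smul (\<lambda>n. if i < d then S i n z else 0) ((xi_a ^^ i) \<psi>))" for z \<psi>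
    using assms(2) by (intro sum.mono_neutral_cong_left) (auto simp: xi_smul_zero)
  with S show ?thesis
    unfolding left_form_def
    by (intro exI[of _ "\<lambda>i n z. if i < d then S i n z else 0"])
      (auto simp: hol_fs_def intro!: holo_on_intros)
qed

lemma left_form_smul:
  assumes "left_form I V d F" "hol_fs I V R"
  shows "left_form I V d (\<lambda>z \<psi>. xi_smul (\<lambda>n. R n z) (F z \<psi>))"
proof -
  obtain S where S: "\<forall>i<d. hol_fs I V (S i)"
    "\<forall>z\<in>V. \<forall>\<psi>. F z \<psi> = (\<Sum>i<d. xi_smul (\<lambda>n. S i n z) ((xi_a ^^ i) \<psi>))"
    using assms(1) unfolding left_form_def by blast
  show ?thesis
    unfolding left_form_def
    by (rule exI[of _ "\<lambda>i n z. \<Sum>t\<le>n. R t z * S i (n - t) z"])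
      (use S assms(2) in \<open>auto simp: xi_smul_sum xi_smul_xi_smul hol_fs_def intro!: holo_on_intros\<close>)
qed

lemma left_form_0: "left_form I V d (\<lambda>z \<psi>. 0)"
  unfolding left_form_def
  by (rule exI[of _ "\<lambda>i n z. 0"]) (auto simp: xi_smul_zero hol_fs_def holo_on_const)

lemma left_form_sum:
  "(\<And>i. i \<in> A \<Longrightarrow> left_form I V d (F i)) \<Longrightarrow> left_form I V d (\<lambda>z \<psi>. \<Sum>i\<in>A. F i z \<psi>)"
  by (induction A rule: infinite_finite_induct)
    (auto simp only: sum.infinite sum.empty sum.insert not_False_eq_True intro!: left_form_add left_form_0)

lemma left_form_cong:
  assumes "left_form I V d F" "\<And>z \<psi>. z \<in> V \<Longrightarrow> F z \<psi> = G z \<psi>"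
  shows "left_form I V d G"
  using assms by (simp add: left_form_def)

lemma left_form_comp_a:
  assumes "left_form I V d F"
  shows "left_form I V (Suc d) (\<lambda>z \<psi>. F z (xi_a \<psi>))"
proof -
  obtain S where S: "\<forall>i<d. hol_fs I V (S i)"
    "\<forall>z\<in>V. \<forall>\<psi>. F z \<psi> = (\<Sum>i<d. xi_smul (\<lambda>n. S i n z) ((xi_a ^^ i) \<psi>))"
    using assms(1) unfolding left_form_def by blast
  have "(\<Sum>i<d. xi_smul (\<lambda>n. S i n z) ((xi_a ^^ i) (xi_a \<psi>)))
    = (\<Sum>i<Suc d. xi_smul (\<lambda>n. if i = 0 then 0 else S (i - 1) n z) ((xi_a ^^ i) \<psi>))" for z \<psi>
    by (subst sum.lessThan_Suc_shift) (simp add: xi_smul_zero funpow_swap1)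
  with S show ?thesis
    unfolding left_form_def
    by (intro exI[of _ "\<lambda>i n z. if i = 0 then 0 else S (i - 1) n z"])
      (auto simp: hol_fs_def intro!: holo_on_intros)
qed

text \<open>By a S = S a + b^2 S', moving a past the coefficients adds one power of a and a
  correction of the old order.\<close>

lemma left_form_a_comp:
  assumes "left_form I V d F"
  shows "left_form I V (Suc d) (\<lambda>z \<psi>. xi_a (F z \<psi>))"
proof -
  obtain S where S: "\<forall>i<d. hol_fs I V (S i)"
    "\<forall>z\<in>V. \<forall>\<psi>. F z \<psi> = (\<Sum>i<d. xi_smul (\<lambda>n. S i n z) ((xi_a ^^ i) \<psi>))"
    using assms(1) unfolding left_form_def by blast
  have "left_form I V d (\<lambda>z \<psi>. \<Sum>i<d. xi_smul (bb_deriv (\<lambda>n. S i n z)) ((xi_a ^^ i) \<psi>))"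
    unfolding left_form_def
    by (rule exI[of _ "\<lambda>i n z. bb_deriv (\<lambda>n. S i n z) n"])
      (use S in \<open>auto simp: hol_fs_def bb_deriv_def[abs_def] intro!: holo_on_intros\<close>)
  then have "left_form I V (Suc d)
    (\<lambda>z \<psi>. F z (xi_a \<psi>) + (\<Sum>i<d. xi_smul (bb_deriv (\<lambda>n. S i n z)) ((xi_a ^^ i) \<psi>)))"
    by (rule left_form_add[OF left_form_comp_a[OF assms] left_form_mono]) simp
  then show ?thesis
    by (rule left_form_cong)
      (simp only: S(2) xi_a_sum xi_a_xi_smul sum.distrib funpow_swap1[symmetric])
qed

lemma left_form_smul_id:
  "hol_fs I V S \<Longrightarrow> left_form I V (Suc 0) (\<lambda>z. xi_smul (\<lambda>n. S n z))"
  unfolding left_form_def by (rule exI[of _ "\<lambda>_. S"]) auto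

text \<open>The order d does not grow, because moving a^i past R produces only powers of a up to
  i.\<close>

lemma left_form_comp_smul:
  assumes "left_form I V d F" "hol_fs I V R"
  shows "left_form I V d (\<lambda>z \<psi>. F z (xi_smul (\<lambda>n. R n z) \<psi>))"
proof -
  have pow: "left_form I V (Suc i) (\<lambda>z \<psi>. (xi_a ^^ i) (xi_smul (\<lambda>n. R n z) \<psi>))" for i
    by (induction i) (auto intro: left_form_smul_id left_form_a_comp assms)
  obtain S where S: "\<forall>i<d. hol_fs I V (S i)"
    "\<forall>z\<in>V. \<forall>\<psi>. F z \<psi> = (\<Sum>i<d. xi_smul (\<lambda>n. S i n z) ((xi_a ^^ i) \<psi>))"
    using assms(1) unfolding left_form_def by blast
  have "left_form I V d (\<lambda>z \<psi>. \<Sum>i<d. xi_smul (\<lambda>n. S i n z) ((xi_a ^^ i) (xi_smul (\<lambda>n. R n z) \<psi>)))"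
    by (intro left_form_sum left_form_smul left_form_mono[OF pow]) (use S in auto)
  then show ?thesis
    by (rule left_form_cong) (simp only: S(2))
qed

lemma left_form_xi_d: "left_form I V 2 (\<lambda>z. xi_d c)"
  unfolding left_form_def
proof (rule exI[of _ "\<lambda>i n z. if i = 0 then if n = 1 then - c else 0 else if n = 0 then 1 else 0"], intro conjI allI ballI impI)
  fix \<psi> :: xi and z :: pt
  show "xi_d c \<psi> = (\<Sum>i<2. xi_smul (\<lambda>n. if i = 0 then if n = 1 then - c else 0 else if n = 0 then 1 else 0)
            ((xi_a ^^ i) \<psi>))"
    by (auto simp: fun_eq_iff numeral_2_eq_2 xi_d_def xi_b_def xi_smul_def
        if_distrib[of "\<lambda>x. x * _"] cong: if_cong)
qed (auto simp: hol_fs_def holo_on_const)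

lemma left_form_comp_xi_d:
  assumes "left_form I V d F"
  shows "left_form I V (Suc d) (\<lambda>z \<psi>. F z (xi_d c \<psi>))"
proof -
  have pow: "left_form I V (Suc (Suc i)) (\<lambda>z \<psi>. (xi_a ^^ i) (xi_d c \<psi>))" for i
    using left_form_xi_d[of I V c]
    by (induction i) (auto simp: numeral_2_eq_2 intro: left_form_a_comp)
  obtain S where S: "\<forall>i<d. hol_fs I V (S i)"
    "\<forall>z\<in>V. \<forall>\<psi>. F z \<psi> = (\<Sum>i<d. xi_smul (\<lambda>n. S i n z) ((xi_a ^^ i) \<psi>))"
    using assms(1) unfolding left_form_def by blast
  have "left_form I V (Suc d) (\<lambda>z \<psi>. \<Sum>i<d. xi_smul (\<lambda>n. S i n z) ((xi_a ^^ i) (xi_d c \<psi>)))"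
    by (intro left_form_sum left_form_smul left_form_mono[OF pow]) (use S in auto)
  then show ?thesis
    by (rule left_form_cong) (simp only: S(2))
qed

section \<open>The canonical family\<close>

text \<open>A solution of \<open>(a - (l0 + M) b) \<psi> = g\<close>: on \<open>b^m\<close> with \<open>m \<noteq> M\<close> this is a finite Neumann series in
  the nilpotent shift of logarithms, while \<open>m = M\<close> raises the degree in the logarithm. The value 1 at \<open>b^M e\<^bsub>l0,0\<^esub>\<close> adds a solution of the
  homogeneous equation, so that \<open>g = 0\<close> yields \<open>b^M e\<^bsub>l0,0\<^esub>\<close>.\<close>

definition xi_solve :: "nat \<Rightarrow> rat \<Rightarrow> nat \<Rightarrow> xi \<Rightarrow> xi" where
  "xi_solve N l0 M g l m j =
    (if l \<noteq> l0 then 0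
     else if m = M then (case j of 0 \<Rightarrow> 1 | Suc i \<Rightarrow> g l (Suc M) i)
     else (\<Sum>t<N. (- 1) ^ t * g l (Suc m) (j + t) / (of_nat m - of_nat M) ^ Suc t))"

text \<open>d plus the shift of h is applied to the truncated Neumann series; neighbouring terms
  cancel, leaving an error that vanishes once the logarithms are exhausted.\<close>

lemma neumann_telescope:
  fixes d :: complex
  assumes "d \<noteq> 0"
  shows "d * (\<Sum>t<N. (- 1) ^ t * h t / d ^ Suc t) + (\<Sum>t<N. (- 1) ^ t * h (Suc t) / d ^ Suc t)
    = h 0 - (- 1) ^ N * h N / d ^ N"
proof (induction N)
  case (Suc N)
  have "d * ((- 1) ^ N * h N / d ^ Suc N) = (- 1) ^ N * h N / d ^ N"
    using assms by simp
  with Suc show ?case by (simp add: distrib_left algebra_simps)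
qed simp

lemma xi_d_xi_solve:
  assumes "\<And>l m j. l \<noteq> l0 \<Longrightarrow> g l m j = 0" "\<And>l m j. j \<ge> N \<Longrightarrow> g l m j = 0" "\<And>l j. g l 0 j = 0"
  shows "xi_d (of_rat l0 + of_nat M) (xi_solve N l0 M g) = g"
proof (intro ext)
  fix l m j
  show "xi_d (of_rat l0 + of_nat M) (xi_solve N l0 M g) l m j = g l m j"
  proof (cases "l = l0 \<and> m > 0")
    case False
    then show ?thesis by (auto simp: xi_d_def xi_a_def xi_b_def xi_solve_def assms)
  next
    case True
    then obtain n where [simp]: "m = Suc n" "l = l0" by (cases m) auto
    \<comment> \<open>Each degree in b gives its own recurrence in the logarithm. At n = M the
      diagonal factor vanishes: the log^0 coefficient is free and the higher ones are
      prescribed.\<close>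
    have *: "xi_d (of_rat l0 + of_nat M) (xi_solve N l0 M g) l m j
        = (of_nat n - of_nat M) * xi_solve N l0 M g l0 n j + xi_solve N l0 M g l0 n (Suc j)"
      by (simp add: xi_d_def xi_a_def xi_b_def algebra_simps)
    show ?thesis
    proof (cases "n = M")
      case True
      then show ?thesis unfolding * by (simp add: xi_solve_def)
    next
      case False
      then have "(of_nat n - of_nat M :: complex) \<noteq> 0" by simp
      from neumann_telescope[OF this, where h = "\<lambda>t. g l0 (Suc n) (j + t)" and N = N] False
      show ?thesis unfolding * by (simp add: xi_solve_def assms(2))
    qed
  qed
qed

locale canonical_family =
  fixes k :: nat and l1 :: rat and p :: "nat \<Rightarrow> nat"
  assumes k_pos: "k \<ge> 1" and l1_gt: "l1 > of_nat k - 1"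
begin

section \<open>Exponents and the vectors phi_j\<close>

definition S :: "nat \<Rightarrow> pt \<Rightarrow> complex fps" where
  "S j z = fps_of_poly (Spoly (Icoord k p) z j)"

text \<open>The \<lambda>_j differ by integers, so they share one representative in ]0,1]. For 1
  \<le> j \<le> k, \<open>ex j\<close> is the offset for which a - \<lambda>_j b kills b^(ex j)
  e_(l0,0).\<close>

definition l0 :: rat where "l0 = l1 - of_int (\<lceil>l1\<rceil> - 1)"

definition ex :: "nat \<Rightarrow> nat" where "ex j = nat (\<lceil>lam l1 p j\<rceil> - 1)"

text \<open>Starting from 0 makes phi_1 the homogeneous solution b^(ex 1) e_(l0,0). Neumann sums of
  length k suffice, since phi_j has degree below j in the logarithm.\<close>

fun phi :: "nat \<Rightarrow> pt \<Rightarrow> xi" where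
  "phi 0 z = 0"
| "phi (Suc j) z = xi_solve k l0 (ex (Suc j)) (xi_smul (fps_nth (S j z)) (phi j z))"

lemma l0_range: "l0 \<in> {0<..1}"
  unfolding l0_def by (simp; linarith)

lemma lam_Suc: "j \<ge> 1 \<Longrightarrow> lam l1 p (Suc j) = lam l1 p j + of_nat (p j) - 1"
  by (simp add: lam_def)

text \<open>As p_j \<ge> 0, one step lowers the exponent by at most one.\<close>

lemma lam_gt: "j \<ge> 1 \<Longrightarrow> lam l1 p j > of_nat k - of_nat j"
proof (induction j rule: dec_induct)
  case base
  then show ?case using l1_gt by (simp add: lam_def)
next
  case (step j)
  have "lam l1 p (Suc j) \<ge> lam l1 p j - 1"
    using lam_Suc[of j] step.hyps by simp
  then show ?case using step.IH by simp
qed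

lemma ex_ge: "1 \<le> j \<Longrightarrow> k - j \<le> ex j"
proof -
  assume "1 \<le> j"
  then have "of_int (int k - int j) < lam l1 p j" using lam_gt[of j] by simp
  then have "int k - int j < \<lceil>lam l1 p j\<rceil>" by (simp only: less_ceiling_iff)
  then show ?thesis unfolding ex_def by linarith
qed

text \<open>Positivity of \<lambda>_j keeps \<open>nat\<close> from truncating in
  \<open>ex\<close>.\<close>

lemma lam_eq: "1 \<le> j \<Longrightarrow> j \<le> k \<Longrightarrow> lam l1 p j = l0 + of_nat (ex j)"
proof -
  assume j: "1 \<le> j" "j \<le> k"
  define t :: int where "t = (\<Sum>i\<in>{1..<j}. int (p i) - 1)"
  have lam: "lam l1 p j = l1 + of_int t"
    by (simp add: lam_def t_def)
  have "(of_nat j :: rat) \<le> of_nat k" using j by simp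
  then have "lam l1 p j > 0"
    using lam_gt[of j] j by linarith
  then have "\<lceil>lam l1 p j\<rceil> \<ge> 1" by simp
  then have "of_nat (ex j) = (of_int (\<lceil>lam l1 p j\<rceil> - 1) :: rat)"
    by (simp add: ex_def of_nat_nat)
  then show ?thesis
    by (simp add: lam l0_def)
qed

text \<open>The resonance: b^(p_j) in S_j moves b^(ex j) to b^(ex (j+1) + 1), exactly the degree at
  which solving for phi_(j+1) creates a new power of the logarithm.\<close>

lemma ex_Suc: "1 \<le> j \<Longrightarrow> j < k \<Longrightarrow> Suc (ex (Suc j)) = ex j + p j"
proof -
  assume j: "1 \<le> j" "j < k"
  have "of_nat (Suc (ex (Suc j))) = (of_nat (ex j + p j) :: rat)"
    using lam_Suc[of j] lam_eq[of j] lam_eq[of "Suc j"] j by simp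
  then show ?thesis by (simp only: of_nat_eq_iff)
qed

lemma phi_exponent: "l \<noteq> l0 \<Longrightarrow> phi j z l m n = 0"
  by (cases j) (auto simp: xi_solve_def)

lemma phi_log: "n \<ge> j \<Longrightarrow> phi j z l m n = 0"
  by (induction j arbitrary: l m n)
    (auto simp: xi_solve_def xi_smul_def split: nat.split intro!: sum.neutral)

text \<open>Solving loses one power of b per step, and by \<open>ex_ge\<close> the homogeneous and
  resonant terms start no earlier.\<close>

lemma phi_order: "m < k - j \<Longrightarrow> phi j z l m n = 0"
proof (induction j arbitrary: l m n)
  case (Suc j)
  have "m \<noteq> ex (Suc j)" using ex_ge[of "Suc j"] Suc.prems by auto
  then show ?case
    using Suc by (auto simp: xi_solve_def xi_smul_def intro!: sum.neutral)
qed auto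

text \<open>The image of a - \<lambda> b is divisible by b; for j < k, \<open>phi_order\<close>
  gives this divisibility of the right-hand side.\<close>

lemma xi_d_phi:
  assumes "j < k"
  shows "xi_d (of_rat (lam l1 p (Suc j))) (phi (Suc j) z) = xi_smul (fps_nth (S j z)) (phi j z)"
proof -
  have "xi_d (of_rat l0 + of_nat (ex (Suc j))) (phi (Suc j) z) = xi_smul (fps_nth (S j z)) (phi j z)"
    unfolding phi.simps
    by (rule xi_d_xi_solve)
      (use assms in \<open>auto simp: xi_smul_def phi_exponent phi_log phi_order intro!: sum.neutral\<close>)
  then show ?thesis
    using lam_eq[of "Suc j"] assms by (simp add: of_rat_add)
qed

text \<open>A new logarithm arises only at the resonant exponent. Its coefficient sits one power of
  b higher in S_j phi_j, where by \<open>ex_Suc\<close> only b^(p_j) of S_j meets the top monomial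
  of phi_j.\<close>

lemma phi_top:
  assumes "j < k"
  shows "phi (Suc j) z l0 m j = (if m = ex (Suc j) then \<Prod>i\<in>{1..j}. fps_nth (S i z) (p i) else 0)"
  using assms
proof (induction j arbitrary: m)
  case 0
  have "xi_smul (fps_nth (S 0 z)) 0 = 0" by (rule xi_smul_zero)
  then show ?case by (simp add: xi_solve_def)
next
  case (Suc j)
  define g where "g = xi_smul (fps_nth (S (Suc j) z)) (phi (Suc j) z)"
  have phi: "phi (Suc (Suc j)) z = xi_solve k l0 (ex (Suc (Suc j))) g"
    by (simp add: g_def)
  show ?case
  proof (cases "m = ex (Suc (Suc j))")
    case False
    have "g l m (Suc j + t) = 0" for l m t
      using phi_log[of "Suc j" "Suc j + t" z] by (simp add: g_def xi_smul_def del: phi.simps)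
    then show ?thesis
      using False unfolding phi by (simp add: xi_solve_def)
  next
    case True
    have e: "Suc (ex (Suc (Suc j))) = ex (Suc j) + p (Suc j)"
      using Suc.prems by (intro ex_Suc) auto
    have "phi (Suc (Suc j)) z l0 m (Suc j) = g l0 (ex (Suc j) + p (Suc j)) j"
      unfolding phi using True e by (simp add: xi_solve_def)
    also have "\<dots> = (\<Sum>n\<le>ex (Suc j) + p (Suc j). if n = p (Suc j)
        then fps_nth (S (Suc j) z) n * (\<Prod>i\<in>{1..j}. fps_nth (S i z) (p i)) else 0)"
      unfolding g_def xi_smul_def using Suc.prems
      by (intro sum.cong refl) (auto simp: Suc.IH simp del: phi.simps)
    finally show ?thesis using True by (simp add: mult.commute)
  qed
qed

section \<open>The series S_j and their holomorphic dependence\<close>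

lemma finite_Icoord: "finite {i. (j, i) \<in> Icoord k p}"
  by (rule finite_subset[of _ "{..k} \<union> {qq k p j}"]) (auto simp: Icoord_def)

lemma S_nth: "fps_nth (S j z) n = (if n = 0 then 1 else 0) + (if (j, n) \<in> Icoord k p then z (j, n) else 0)"
proof -
  have "(\<Sum>i\<in>{i. (j, i) \<in> Icoord k p}. coeff (monom (z (j, i)) i) n)
      = (\<Sum>i\<in>{i. (j, i) \<in> Icoord k p}. if i = n then z (j, n) else 0)"
    by (intro sum.cong) auto
  then show ?thesis
    using finite_Icoord[of j] by (auto simp: S_def Spoly_def coeff_sum)
qed

text \<open>The exponent 0 is never a free coordinate, because q_j \<ge> k - j > 0.\<close>

lemma S_0 [simp]: "fps_nth (S j z) 0 = 1"
proof -
  have "(j, 0) \<notin> Icoord k p"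
  proof
    assume a: "(j, 0) \<in> Icoord k p"
    then have j: "1 \<le> j" "j \<le> k - 1" and nsm: "\<not> smallcase k p j" and q: "qq k p j = 0"
      by (auto simp: Icoord_def)
    \<comment> \<open>h = k - 1 - j is a witness for the least h in q_j, by the failure of
      \<open>smallcase\<close>.\<close>
    have "j + (k - 1 - j) = k - 1" using j by simp
    then have "k - j \<le> (\<Sum>i\<in>{j..j + (k - 1 - j)}. p i)"
      using nsm by (simp only: smallcase_def not_less)
    then have "k - j \<le> qq k p j"
      unfolding qq_def by (rule LeastI)
    then show False using q j by simp
  qed
  then show ?thesis by (simp add: S_nth)
qed

lemma S_index_0: "S 0 z = 1"
proof -
  have "{i. (0, i) \<in> Icoord k p} = {}" by (auto simp: Icoord_def)
  then show ?thesis by (simp add: S_def Spoly_def)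
qed

lemma holo_on_S: "holo_on I V (\<lambda>z. fps_nth (S j z) n)"
  unfolding S_nth by (intro holo_on_intros)

lemma hol_fs_S: "hol_fs I V (\<lambda>n z. fps_nth (S j z) n)"
  by (simp add: hol_fs_def holo_on_S)

lemma hol_fs_inverse_S: "hol_fs I V (\<lambda>n z. fps_nth (inverse (S j z)) n)"
  by (simp add: hol_fs_def holo_on_S holo_on_fps_inverse)

text \<open>Only ring operations and divisions by constants m - \<open>ex (Suc j)\<close>,
  independent of z, occur.\<close>

lemma holo_on_phi: "holo_on I V (\<lambda>z. phi j z l m n)"
proof (induction j arbitrary: l m n)
  case (Suc j)
  show ?case
    by (cases n) (auto simp: xi_solve_def xi_smul_def intro!: holo_on_intros Suc.IH holo_on_S)
qed (simp add: holo_on_const)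

lemma S_inverse_smul:
  "xi_smul (fps_nth (S j z)) (xi_smul (fps_nth (inverse (S j z))) \<psi>) = \<psi>"
  "xi_smul (fps_nth (inverse (S j z))) (xi_smul (fps_nth (S j z)) \<psi>) = \<psi>"
  by (simp_all add: xi_smul_fps_mult inverse_mult_eq_1 inverse_mult_eq_1' xi_smul_one)

section \<open>The operator defined by P\<close>

text \<open>The left part of P that ends with a - \<lambda>_j b. It also carries S_0^(-1) at the far
  left, which is 1 by \<open>S_index_0\<close>.\<close>

fun Pop :: "nat \<Rightarrow> pt \<Rightarrow> xi \<Rightarrow> xi" where
  "Pop 0 z \<psi> = \<psi>"
| "Pop (Suc j) z \<psi> = Pop j z (xi_smul (fps_nth (inverse (S j z))) (xi_d (of_rat (lam l1 p (Suc j))) \<psi>))"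

lemma Pop_phi: "j \<le> k \<Longrightarrow> Pop j z (phi j z) = 0"
proof (induction j)
  case (Suc j)
  have "Pop (Suc j) z (phi (Suc j) z) = Pop j z (phi j z)"
    using xi_d_phi[of j z] Suc.prems by (simp add: S_inverse_smul del: phi.simps)
  then show ?case using Suc by simp
qed simp

lemma act_foldr: "act (foldr ncmul xs nc_one) \<psi> = foldr act xs \<psi>"
  by (induction xs) (simp_all add: act_ncmul act_nc_one)

lemma act_Pcan: "act (Pcan k l1 p z) \<psi> = Pop k z \<psi>"
proof -
  define L where "L n = concat (map (\<lambda>j. [(\<lambda>\<nu> i. nc_a \<nu> i - of_rat (lam l1 p j) * nc_b \<nu> i),
      nc_ser (fps_nth (inverse (S j z)))]) [1..<n])" for n
  have "foldr act (L n) (xi_d (of_rat (lam l1 p n)) \<psi>) = Pop n z \<psi>" if "n \<ge> 1" for n \<psi>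
    using that
  proof (induction n arbitrary: \<psi> rule: dec_induct)
    case base
    then show ?case by (simp add: L_def S_index_0 xi_smul_one)
  next
    case (step n)
    then show ?case
      by (simp add: L_def act_nc_a_minus_b act_nc_ser)
  qed
  moreover have "act (Pcan k l1 p z) \<psi> = foldr act (L k @ [\<lambda>\<nu> i. nc_a \<nu> i - of_rat (lam l1 p k) * nc_b \<nu> i]) \<psi>"
  proof -
    have "Pfac k l1 p z = L k @ [(\<lambda>\<nu> i. nc_a \<nu> i - of_rat (lam l1 p k) * nc_b \<nu> i)]"
      by (simp add: Pfac_def L_def S_def)
    then show ?thesis by (simp only: Pcan_def act_foldr)
  qed
  ultimately show ?thesis
    using k_pos by (simp add: act_nc_a_minus_b)
qed

section \<open>Annihilators and generators, by descent on j\<close>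

text \<open>Only the remainder contributes to the highest power of the logarithm in \<open>x \<cdot> phi (Suc j)\<close>.\<close>

lemma annihilator_step:
  assumes z: "z \<in> Sspace k p" and j: "j < k" and x: "act x (phi (Suc j) z) = 0"
  defines "c \<equiv> of_rat (lam l1 p (Suc j))"
  shows "div_rem c x = (\<lambda>_. 0)" and "act (div_quot c x) (xi_smul (fps_nth (S j z)) (phi j z)) = 0"
proof -
  have eq: "act (div_quot c x) (xi_smul (fps_nth (S j z)) (phi j z)) + xi_smul (div_rem c x) (phi (Suc j) z) = 0"
    using act_div[of x "phi (Suc j) z" c] unfolding x c_def xi_d_phi[OF j] by (rule sym)
  define C where "C = (\<Prod>i\<in>{1..j}. fps_nth (S i z) (p i))"
  \<comment> \<open>Here the nonvanishing conditions that cut out \<open>Sspace\<close>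
    enter.\<close>
  have C: "C \<noteq> 0"
    using z j by (auto simp: C_def Sspace_def S_def)
  have "div_rem c x n = 0" for n
  proof -
    \<comment> \<open>The log^j part of r phi_(j+1) is r C b^(ex (j+1)), so the coefficient of b^M
      isolates r_n.\<close>
    define M where "M = n + ex (Suc j)"
    have "act (div_quot c x) (xi_smul (fps_nth (S j z)) (phi j z)) l0 M j = 0"
      by (rule act_log[where J = j]) (simp_all add: xi_smul_def phi_log)
    then have "0 = xi_smul (div_rem c x) (phi (Suc j) z) l0 M j"
      using fun_cong[OF fun_cong[OF fun_cong[OF eq]], of l0 M j] by (simp del: phi.simps)
    also have "\<dots> = (\<Sum>t\<le>M. if t = n then div_rem c x n * C else 0)"
      unfolding xi_smul_def phi_top[OF j] C_def[symmetric]
      by (intro sum.cong refl) (auto simp: M_def)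
    also have "\<dots> = div_rem c x n * C" by (simp add: M_def)
    finally show ?thesis using C by simp
  qed
  then show r: "div_rem c x = (\<lambda>_. 0)" by blast
  show "act (div_quot c x) (xi_smul (fps_nth (S j z)) (phi j z)) = 0"
    using eq unfolding r xi_smul_zero add_0_right .
qed

text \<open>Inserting S_j S_j^(-1) between quotient q and divisor exhibits q S_j, the element passed
  to phi_j in the descent.\<close>

lemma act_div_S:
  assumes "div_rem (of_rat (lam l1 p (Suc j))) x = (\<lambda>_. 0)"
  shows "act x \<psi> = act (ncmul (div_quot (of_rat (lam l1 p (Suc j))) x) (nc_ser (fps_nth (S j z))))
    (xi_smul (fps_nth (inverse (S j z))) (xi_d (of_rat (lam l1 p (Suc j))) \<psi>))"
  by (subst act_div[of x \<psi> "of_rat (lam l1 p (Suc j))"])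
    (simp add: assms xi_smul_zero act_ncmul act_nc_ser S_inverse_smul)

text \<open>Freeness in one fibre: each division lowers the degree in a, and after j of them nothing
  is left.\<close>

lemma annihilator_degree:
  assumes "z \<in> Sspace k p" "j \<le> k" "act x (phi j z) = 0" "\<And>n i. i \<ge> j \<Longrightarrow> x n i = 0"
  shows "act x \<psi> = 0"
  using assms(2-)
proof (induction j arbitrary: x \<psi>)
  case 0
  then have "x = 0" by (simp add: fun_eq_iff)
  then show ?case by (simp only: act_0)
next
  case (Suc j)
  define c :: complex where "c = of_rat (lam l1 p (Suc j))"
  define y where "y = ncmul (div_quot c x) (nc_ser (fps_nth (S j z)))"
  note step = annihilator_step[OF assms(1) Suc_le_lessD[OF Suc.prems(1)] Suc.prems(2), folded c_def]
  have y0: "act y (phi j z) = 0"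
    using step(2) by (simp add: y_def act_ncmul act_nc_ser del: phi.simps)
  have y_degree: "y n i = 0" if "i \<ge> j" for n i
    unfolding y_def
    by (rule ncmul_degree[where d = j and e = 0])
      (use that div_quot_degree[OF Suc.prems(3)] in \<open>simp_all add: nc_ser_def\<close>)
  show ?case
    unfolding act_div_S[of j x \<psi> z, folded c_def, OF step(1)] y_def[symmetric]
    by (rule Suc.IH[OF Suc_leD[OF Suc.prems(1)] y0 y_degree])
qed

text \<open>The same descent without a degree bound: what survives all divisions is the holomorphic
  cofactor of P.\<close>

lemma annihilator_ATU:
  assumes "V \<subseteq> Sspace k p" "j \<le> k" "X \<in> ATU I V" "\<And>z. z \<in> V \<Longrightarrow> act (X z) (phi j z) = 0"
  shows "\<exists>Y\<in>ATU I V. \<forall>z\<in>V. \<forall>\<psi>. act (X z) \<psi> = act (Y z) (Pop j z \<psi>)"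
  using assms(2-)
proof (induction j arbitrary: X)
  case 0
  then show ?case by auto
next
  case (Suc j)
  define c :: complex where "c = of_rat (lam l1 p (Suc j))"
  define X' where "X' z = ncmul (div_quot c (X z)) (nc_ser (fps_nth (S j z)))" for z
  have X': "X' \<in> ATU I V"
    unfolding X'_def[abs_def]
    by (rule ATU_ncmul[OF ATU_div_quot[OF Suc.prems(2)] ATU_nc_ser[OF hol_fs_S]])
  have z: "z \<in> Sspace k p" if "z \<in> V" for z using assms(1) that by auto
  have step: "div_rem c (X z) = (\<lambda>_. 0)" "act (div_quot c (X z)) (xi_smul (fps_nth (S j z)) (phi j z)) = 0"
    if "z \<in> V" for z
    unfolding c_def
    by (rule annihilator_step[OF z[OF that] Suc_le_lessD[OF Suc.prems(1)] Suc.prems(3)[OF that]])+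
  have "act (X' z) (phi j z) = 0" if "z \<in> V" for z
    using step(2)[OF that] by (simp add: X'_def act_ncmul act_nc_ser del: phi.simps)
  then obtain Y where Y: "Y \<in> ATU I V" "\<And>z \<psi>. z \<in> V \<Longrightarrow> act (X' z) \<psi> = act (Y z) (Pop j z \<psi>)"
    using Suc.IH[OF _ X'] Suc.prems(1) by auto
  have "act (X z) \<psi> = act (Y z) (Pop (Suc j) z \<psi>)" if "z \<in> V" for z \<psi>
  proof -
    show ?thesis
      using step(1)[OF that] act_div_S[of j "X z" \<psi> z, folded c_def] Y(2)[OF that] by (simp add: X'_def c_def)
  qed
  then show ?case using Y(1) by blast
qed

text \<open>Dividing gives X phi_(j+1) = X' phi_j + r phi_(j+1). Substituting phi_j = S_j^(-1) (a -
  \<lambda>_(j+1) b) phi_(j+1) turns a form of order j at phi_j into one of order j + 1.\<close>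

lemma act_phi_left_form:
  assumes "j \<le> k" "X \<in> ATU I V"
  shows "\<exists>F. left_form I V j F \<and> (\<forall>z\<in>V. act (X z) (phi j z) = F z (phi j z))"
  using assms
proof (induction j arbitrary: X)
  case 0
  show ?case
    by (rule exI[of _ "\<lambda>z \<psi>. 0"]) (simp only: left_form_0 phi.simps act_zero_right simp_thms ball_triv)
next
  case (Suc j)
  define c :: complex where "c = of_rat (lam l1 p (Suc j))"
  define X' where "X' z = ncmul (div_quot c (X z)) (nc_ser (fps_nth (S j z)))" for z
  have X': "X' \<in> ATU I V"
    unfolding X'_def[abs_def]
    by (rule ATU_ncmul[OF ATU_div_quot[OF Suc.prems(2)] ATU_nc_ser[OF hol_fs_S]])
  obtain F where F: "left_form I V j F" "\<And>z. z \<in> V \<Longrightarrow> act (X' z) (phi j z) = F z (phi j z)"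
    using Suc.IH[OF _ X'] Suc.prems(1) by auto
  define G where "G z \<psi> = F z (xi_smul (fps_nth (inverse (S j z))) (xi_d c \<psi>)) + xi_smul (div_rem c (X z)) \<psi>"
    for z \<psi>
  have "left_form I V (Suc j) (\<lambda>z \<psi>. F z (xi_smul (fps_nth (inverse (S j z))) (xi_d c \<psi>)))"
    by (rule left_form_comp_xi_d[OF left_form_comp_smul[OF F(1) hol_fs_inverse_S]])
  moreover have "left_form I V (Suc j) (\<lambda>z. xi_smul (div_rem c (X z)))"
    by (rule left_form_mono[OF left_form_smul_id[OF hol_fs_div_rem[OF Suc.prems(2)]]]) simp
  ultimately have "left_form I V (Suc j) G"
    unfolding G_def[abs_def] by (rule left_form_add)
  moreover have "act (X z) (phi (Suc j) z) = G z (phi (Suc j) z)" if "z \<in> V" for z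
  proof -
    have "act (X z) (phi (Suc j) z) = act (X' z) (phi j z) + xi_smul (div_rem c (X z)) (phi (Suc j) z)"
      using act_div[of "X z" "phi (Suc j) z" c] xi_d_phi[of j z] Suc.prems(1)
      by (simp add: X'_def c_def act_ncmul act_nc_ser del: phi.simps)
    then show ?thesis
      using F(2)[OF that] xi_d_phi[of j z] Suc.prems(1)
      by (simp add: G_def c_def S_inverse_smul del: phi.simps)
  qed
  ultimately show ?case by blast
qed

lemma act_phi_Ephi:
  assumes "X \<in> ATU I V"
  shows "(\<lambda>z. act (X z) (phi k z)) \<in> Ephi k I V (phi k)"
  using act_phi_left_form[OF order_refl assms] unfolding left_form_def Ephi_def by auto

section \<open>Thematicity and the quotient isomorphism\<close>

lemma thematic_phi: "thematic k I (Sspace k p) {l0} k (phi k)"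
  unfolding thematic_def
proof (intro conjI allI impI)
  show "phi k \<in> XiN I (Sspace k p) {l0} k"
    by (auto simp: XiN_def holo_on_phi phi_exponent phi_log)
next
  fix V \<nu>
  show "(\<lambda>z. (xi_a ^^ \<nu>) (phi k z)) \<in> Ephi k I V (phi k)"
    using act_phi_Ephi[OF ATU_nc_apow[of \<nu> I V]] by (simp add: act_nc_apow)
next
  fix V and T :: "nat \<Rightarrow> fs" and i n
  assume V: "openS I V \<and> V \<subseteq> Sspace k p" and i: "i < k"
    and T: "(\<forall>i<k. hol_fs I V (T i)) \<and> (\<forall>z\<in>V. (\<Sum>i<k. xi_smul (\<lambda>n. T i n z) ((xi_a ^^ i) (phi k z))) = 0)"
  show "\<forall>z\<in>V. T i n z = 0"
  proof
    fix z assume z: "z \<in> V"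
    \<comment> \<open>In each fibre a relation is an element of degree below k in a that kills
      \<open>phi k z\<close>.\<close>
    define x where "x = nc_left_form k (\<lambda>i n. T i n z)"
    have z': "z \<in> Sspace k p" using V z by auto
    have x0: "act x (phi k z) = 0"
      unfolding x_def act_nc_left_form using T z by blast
    have "act x \<psi> = 0" for \<psi>
      by (rule annihilator_degree[OF z' order_refl x0]) (simp add: x_def nc_left_form_degree)
    then have "(\<Sum>i<k. xi_smul (\<lambda>n. T i n z) ((xi_a ^^ i) \<psi>)) = 0" for \<psi>
      by (simp only: x_def act_nc_left_form)
    from left_form_eq_0_imp[OF this i] show "T i n z = 0"
      by (rule fun_cong)
  qed
qed

lemma act_eq_iff_congP:
  assumes "V \<subseteq> Sspace k p" "X \<in> ATU I V" "X' \<in> ATU I V"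
  shows "(\<forall>z\<in>V. act (X z) (phi k z) = act (X' z) (phi k z)) \<longleftrightarrow> congP I V (Pcan k l1 p) X X'"
proof
  assume eq: "\<forall>z\<in>V. act (X z) (phi k z) = act (X' z) (phi k z)"
  then obtain Y where Y: "Y \<in> ATU I V" "\<And>z \<psi>. z \<in> V \<Longrightarrow> act (X z - X' z) \<psi> = act (Y z) (Pop k z \<psi>)"
    using annihilator_ATU[OF assms(1) order_refl ATU_diff[OF assms(2,3)]] by (auto simp: act_diff)
  \<comment> \<open>Faithfulness lifts the equality of operators to the algebra.\<close>
  have "X z - X' z = ncmul (Y z) (Pcan k l1 p z)" if "z \<in> V" for z
    by (rule act_inject) (simp only: Y(2)[OF that] act_ncmul act_Pcan)
  then show "congP I V (Pcan k l1 p) X X'"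
    unfolding congP_def using Y(1) by blast
next
  assume "congP I V (Pcan k l1 p) X X'"
  then obtain Y where Y: "\<And>z. z \<in> V \<Longrightarrow> X z - X' z = ncmul (Y z) (Pcan k l1 p z)"
    unfolding congP_def by blast
  have "act (X z) (phi k z) - act (X' z) (phi k z) = 0" if "z \<in> V" for z
    unfolding act_diff[symmetric] Y[OF that]
    by (simp add: act_ncmul act_Pcan Pop_phi act_zero_right)
  then show "\<forall>z\<in>V. act (X z) (phi k z) = act (X' z) (phi k z)" by simp
qed

lemma quot_iso_phi:
  assumes "V \<subseteq> Sspace k p"
  shows "quot_iso k I V (Pcan k l1 p) (phi k) (\<lambda>X z. act (X z) (phi k z))"
  unfolding quot_iso_def
proof (intro conjI ballI allI impI)
  fix \<Psi> assume "\<Psi> \<in> Ephi k I V (phi k)"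
  then obtain T :: "nat \<Rightarrow> fs" where T: "\<forall>i<k. hol_fs I V (T i)"
    "\<forall>z\<in>V. \<Psi> z = (\<Sum>i<k. xi_smul (\<lambda>n. T i n z) ((xi_a ^^ i) (phi k z)))"
    unfolding Ephi_def by blast
  show "\<exists>X\<in>ATU I V. \<forall>z\<in>V. act (X z) (phi k z) = \<Psi> z"
    by (rule bexI[OF _ ATU_nc_left_form[of k I V T]]) (use T in \<open>auto simp: act_nc_left_form\<close>)
next
  fix X X' z
  show "act ((X + X') z) (phi k z) = act (X z) (phi k z) + act (X' z) (phi k z)"
    by (simp only: plus_fun_apply act_add)
qed (auto simp: act_eq_iff_congP[OF assms] act_phi_Ephi act_ncmul act_nc_ser act_nc_a)

lemma openS_Sspace: "openS (Icoord k p) (Sspace k p)"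
proof -
  have "open {z :: pt. \<forall>j\<in>{1..k-1}. fps_nth (S j z) (p j) \<noteq> 0}"
  proof -
    \<comment> \<open>With the empty set of coordinates \<open>holo_on\<close> is plain
      continuity.\<close>
    have "continuous_on UNIV (\<lambda>z. fps_nth (S j z) (p j))" for j
      using holo_on_S[of "{}" UNIV j "p j"] by (simp add: holo_on_def)
    then have "open {z :: pt. fps_nth (S j z) (p j) \<noteq> 0}" for j
      by (intro open_Collect_neq) (auto intro: continuous_on_const)
    then show ?thesis
      by (simp add: Collect_ball_eq open_INT)
  qed
  moreover have "Sspace k p = Lsp (Icoord k p) \<inter> {z :: pt. \<forall>j\<in>{1..k-1}. fps_nth (S j z) (p j) \<noteq> 0}"
    by (auto simp: Sspace_def S_def)
  ultimately show ?thesis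
    unfolding openS_def by (simp only: openin_open_Int)
qed

end

theorem theorem5p15:
  fixes k :: nat and l1 :: rat and p :: "nat \<Rightarrow> nat"
  assumes "k \<ge> 1" and "l1 > of_nat k - 1"
  shows "canonical_family_holo_themes k l1 p"
proof -
  interpret canonical_family k l1 p
    by unfold_locales (use assms in auto)
  show ?thesis
    unfolding canonical_family_holo_themes_def Let_def
  \<comment> \<open>The neighbourhood U is the whole parameter space, with the same phi_k for every
    base point.\<close>
  proof (intro ballI exI conjI allI impI)
    show "thematic k (Icoord k p) (Sspace k p) {l0} k (phi k)"
      by (rule thematic_phi)
    show "quot_iso k (Icoord k p) V (Pcan k l1 p) (phi k) (\<lambda>X z. act (X z) (phi k z))"
      if "openS (Icoord k p) V \<and> V \<subseteq> Sspace k p" for V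
      using that by (intro quot_iso_phi) auto
  qed (use openS_Sspace l0_range in auto)
qed

end
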